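(* Let $k$ be an infinite field, $n\ge2$, and $<$ a product order on $k[X_1,\ldots,X_n]$ with $X_1<\cdots<X_n$. Let $A\subseteq k^n$ be a finite union of pairwise distinct affine $d$-planes such that for every irreducible component of $A$, $X_1$ is one of its minimal free variables. For $\lambda\in k$ let $A_\lambda=\{a'\in k^{n-1};\ (\lambda,a')\in A\}$, and let $\delta\subseteq\mathbb{N}^{n-1}$ be the generic standard set, i.e. the common value of $D(A_\lambda)$ (w.r.t. the restriction of $<$ to $k[X_2,\ldots,X_n]$) for all $\lambda$ in some nonempty Zariski-open $U\subseteq k$. Then $\mathbb{N}e_1\oplus\delta:=\{\alpha\in\mathbb{N}^n;\ p(\alpha)\in\delta\}$ is contained in $D(A)$, and it is the largest subset of $D(A)$ that is a union of $1$-planes parallel to $\mathbb{N}e_1$; that is, for $\beta\in\mathbb{N}^{n-1}$, $\{(t,\beta);\ t\in\mathbb{N}\}\subseteq D(A)$ holds if and only if $\beta\in\delta$.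
   Context: $p:\mathbb{N}^n\to\mathbb{N}^{n-1}$ deletes the first coordinate. A term order $<$ on $k[X_1,\ldots,X_n]$ is a product order if $\alpha<\beta$ iff either $p(\alpha)<p(\beta)$, or $p(\alpha)=p(\beta)$ and $\alpha_1<\beta_1$. For $B\subseteq k^m$, $I(B)$ is the vanishing ideal, ${\rm LE}(f)$ the leading exponent, $C(B)=\{{\rm LE}(f);\ 0\ne f\in I(B)\}$, $D(B)=\mathbb{N}^m\setminus C(B)$. A $1$-plane parallel to $\mathbb{N}e_1$ is a set $\gamma+\mathbb{N}e_1$ with $\gamma\in\mathbb{N}^n$, $\gamma_1=0$. An affine $d$-plane is a translate of a $d$-dimensional linear subspace; for $\#J=d$, $\{X_j;\ j\in J\}$ is a set of free variables of an affine $d$-plane $A'$ if the projection $A'\to k^J$ is bijective, and minimal if moreover no exchange of some $j\in J$ by some $i\notin J$ with $i<j$ yields a set of free variables. *)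

theory Defs
  imports "HOL-Computational_Algebra.Polynomial"
begin

text \<open>Conventions. Exponent vectors in N^n are lists of naturals of length n,
points of k^n are lists of length n. Index 0 corresponds to the variable X_1,
index i to X_(i+1). A polynomial in k[X_1,...,X_n] is a finitely supported
coefficient function on exponent vectors of length n.\<close>

definition mpolys :: "nat \<Rightarrow> (nat list \<Rightarrow> 'a::field) set" where
  "mpolys n = {f. finite {\<alpha>. f \<alpha> \<noteq> 0} \<and> (\<forall>\<alpha>. f \<alpha> \<noteq> 0 \<longrightarrow> length \<alpha> = n)}"

definition mp_eval :: "(nat list \<Rightarrow> 'a::field) \<Rightarrow> 'a list \<Rightarrow> 'a" where
  "mp_eval f a = (\<Sum>\<alpha>\<in>{\<alpha>. f \<alpha> \<noteq> 0}. f \<alpha> * (\<Prod>i<length a. (a ! i) ^ (\<alpha> ! i)))"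

definition vanishing_ideal :: "nat \<Rightarrow> 'a::field list set \<Rightarrow> (nat list \<Rightarrow> 'a) set" where
  "vanishing_ideal n B = {f \<in> mpolys n. \<forall>a\<in>B. mp_eval f a = 0}"

definition exps :: "nat \<Rightarrow> nat list set" where
  "exps n = {\<alpha>. length \<alpha> = n}"

definition add_exp :: "nat list \<Rightarrow> nat list \<Rightarrow> nat list" where
  "add_exp \<alpha> \<beta> = map2 (+) \<alpha> \<beta>"

definition unit_exp :: "nat \<Rightarrow> nat \<Rightarrow> nat list" where
  "unit_exp n i = map (\<lambda>j. if j = i then 1 else 0) [0..<n]"

definition term_order :: "nat \<Rightarrow> (nat list \<Rightarrow> nat list \<Rightarrow> bool) \<Rightarrow> bool" where
  "term_order n ord \<longleftrightarrow>
     (\<forall>\<alpha>\<in>exps n. \<not> ord \<alpha> \<alpha>) \<and>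
     (\<forall>\<alpha>\<in>exps n. \<forall>\<beta>\<in>exps n. \<forall>\<gamma>\<in>exps n. ord \<alpha> \<beta> \<longrightarrow> ord \<beta> \<gamma> \<longrightarrow> ord \<alpha> \<gamma>) \<and>
     (\<forall>\<alpha>\<in>exps n. \<forall>\<beta>\<in>exps n. \<alpha> = \<beta> \<or> ord \<alpha> \<beta> \<or> ord \<beta> \<alpha>) \<and>
     wf {(\<alpha>, \<beta>). \<alpha> \<in> exps n \<and> \<beta> \<in> exps n \<and> ord \<alpha> \<beta>} \<and>
     (\<forall>\<alpha>\<in>exps n. \<alpha> \<noteq> replicate n 0 \<longrightarrow> ord (replicate n 0) \<alpha>) \<and>
     (\<forall>\<alpha>\<in>exps n. \<forall>\<beta>\<in>exps n. \<forall>\<gamma>\<in>exps n. ord \<alpha> \<beta> \<longrightarrow> ord (add_exp \<alpha> \<gamma>) (add_exp \<beta> \<gamma>))"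

definition restrict_order :: "(nat list \<Rightarrow> nat list \<Rightarrow> bool) \<Rightarrow> nat list \<Rightarrow> nat list \<Rightarrow> bool" where
  "restrict_order ord \<beta> \<gamma> \<longleftrightarrow> ord (0 # \<beta>) (0 # \<gamma>)"

definition product_order :: "nat \<Rightarrow> (nat list \<Rightarrow> nat list \<Rightarrow> bool) \<Rightarrow> bool" where
  "product_order n ord \<longleftrightarrow>
     (\<forall>\<alpha>\<in>exps n. \<forall>\<beta>\<in>exps n. ord \<alpha> \<beta> \<longleftrightarrow>
        restrict_order ord (tl \<alpha>) (tl \<beta>) \<or> (tl \<alpha> = tl \<beta> \<and> hd \<alpha> < hd \<beta>))"

definition lead_exp :: "(nat list \<Rightarrow> nat list \<Rightarrow> bool) \<Rightarrow> (nat list \<Rightarrow> 'a::field) \<Rightarrow> nat list" where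
  "lead_exp ord f = (THE \<alpha>. f \<alpha> \<noteq> 0 \<and> (\<forall>\<beta>. f \<beta> \<noteq> 0 \<longrightarrow> \<beta> \<noteq> \<alpha> \<longrightarrow> ord \<beta> \<alpha>))"

definition Cset :: "nat \<Rightarrow> (nat list \<Rightarrow> nat list \<Rightarrow> bool) \<Rightarrow> 'a::field list set \<Rightarrow> nat list set" where
  "Cset n ord B = {lead_exp ord f | f. f \<in> vanishing_ideal n B \<and> f \<noteq> (\<lambda>_. 0)}"

definition Dset :: "nat \<Rightarrow> (nat list \<Rightarrow> nat list \<Rightarrow> bool) \<Rightarrow> 'a::field list set \<Rightarrow> nat list set" where
  "Dset n ord B = exps n - Cset n ord B"

definition lincomb :: "nat \<Rightarrow> 'a::field list \<Rightarrow> 'a list list \<Rightarrow> 'a list" where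
  "lincomb n ts vs = map (\<lambda>i. \<Sum>j<length vs. ts ! j * (vs ! j) ! i) [0..<n]"

definition affine_plane :: "nat \<Rightarrow> nat \<Rightarrow> 'a::field list set \<Rightarrow> bool" where
  "affine_plane n d P \<longleftrightarrow> (\<exists>a0 vs. length a0 = n \<and> length vs = d \<and> (\<forall>v\<in>set vs. length v = n) \<and>
      (\<forall>ts. length ts = d \<longrightarrow> lincomb n ts vs = replicate n 0 \<longrightarrow> ts = replicate d 0) \<and>
      P = {map2 (+) a0 (lincomb n ts vs) | ts. length ts = d})"

definition free_vars :: "nat \<Rightarrow> nat \<Rightarrow> 'a::field list set \<Rightarrow> nat set \<Rightarrow> bool" where
  "free_vars n d P J \<longleftrightarrow> J \<subseteq> {..<n} \<and> card J = d \<and>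
     (\<forall>y :: nat \<Rightarrow> 'a. \<exists>!x. x \<in> P \<and> (\<forall>j\<in>J. x ! j = y j))"

definition minimal_free_vars :: "nat \<Rightarrow> nat \<Rightarrow> 'a::field list set \<Rightarrow> nat set \<Rightarrow> bool" where
  "minimal_free_vars n d P J \<longleftrightarrow> free_vars n d P J \<and>
     \<not> (\<exists>j\<in>J. \<exists>i<n. i \<notin> J \<and> i < j \<and> free_vars n d P (insert i (J - {j})))"

definition zariski_open_line :: "'a::field set \<Rightarrow> bool" where
  "zariski_open_line U \<longleftrightarrow> (\<exists>S :: 'a poly set. U = - {x. \<forall>p\<in>S. poly p x = 0})"

definition fiber :: "'a list set \<Rightarrow> 'a \<Rightarrow> 'a list set" where
  "fiber A c = {a'. c # a' \<in> A}"

end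

(* Write k[X_1,...,X_n] as k[X_1][X'], so that LE(f) is (degree of the coefficient of X'^beta, beta)
   with beta the leading exponent in X'. If f lies in I(A), its specialization at a generic value of
   X_1 keeps beta and lies in I(A_lambda); this gives the inclusion. For the converse one shows that
   for generic lambda every element of I(A_lambda) lifts to I(A), adding one plane P at a time: a
   lift F to I(A') restricts on P to a multiple (X_1 - lambda) G, because X_1 is free on P, so
   (X_1 - lambda) G lies in I(A') + I(P). The k[X_1]-torsion modulo this sum is killed by a single
   polynomial in X_1 (Dickson's lemma), so G = a + b with a in I(A') and b in I(P), and
   F - (X_1 - lambda) a is the corrected lift. Finally pseudo-division by finitely many elements of
   I(A) turns a lift into an element of I(A) with the leading exponent of its specialization. *)

theory Submission
  imports Defs
begin

section \<open>Finitely supported coefficient functions\<close>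

text \<open>The obstacle is that I(A_\<lambda>) can be strictly larger than the specialization of
  I(A). For the lines X_2 = 0 and X_2 = X_1 the fiber over 0 is a single point, yet X_2 does not
  lift: I(A) is generated by X_2 (X_2 - X_1), which specializes to X_2^2. In the correction step
  this shows as torsion: X_1 lies in I(A') + I(P), the ideal generated by X_1 and X_2, while 1 does
  not. Such torsion has to be avoided for all G at once, although each torsion element only brings
  its own annihilator in k[X_1]. Passing to leading exponents over k[X_1] makes the problem finite.
  Division there is by cross-multiplication, since leading coefficients are not units; it costs
  factors from k[X_1], and these are harmless as long as they do not vanish at \<lambda>. Each
  exceptional set of parameters is therefore contained in the roots of one nonzero polynomial; these
  polynomials are multiplied together, and the infinite field supplies a common nonroot.\<close>

definition mpols :: "nat \<Rightarrow> (nat list \<Rightarrow> 'b::zero) set" where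
  "mpols m = {f. finite {\<alpha>. f \<alpha> \<noteq> 0} \<and> (\<forall>\<alpha>. f \<alpha> \<noteq> 0 \<longrightarrow> length \<alpha> = m)}"

text \<open>\<open>mpolys\<close> is confined to coefficients in a field, whereas k[X_1][X'] has
  coefficients of type \<open>'a poly\<close>; \<open>mpols\<close> covers both.\<close>

lemma mpolys_eq_mpols: "mpolys m = mpols m"
  by (simp add: mpolys_def mpols_def)

lemma mpols_subsupport:
  assumes "f \<in> mpols m" "\<And>\<alpha>. f \<alpha> = 0 \<Longrightarrow> g \<alpha> = 0"
  shows "g \<in> mpols m"
proof -
  have "{\<alpha>. g \<alpha> \<noteq> 0} \<subseteq> {\<alpha>. f \<alpha> \<noteq> 0}" using assms(2) by auto
  with assms show ?thesis unfolding mpols_def by (auto dest: finite_subset)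
qed

lemma mpols_add:
  fixes f g :: "nat list \<Rightarrow> 'b::monoid_add"
  assumes "f \<in> mpols m" "g \<in> mpols m"
  shows "(\<lambda>\<alpha>. f \<alpha> + g \<alpha>) \<in> mpols m"
proof -
  have "{\<alpha>. f \<alpha> + g \<alpha> \<noteq> 0} \<subseteq> {\<alpha>. f \<alpha> \<noteq> 0} \<union> {\<alpha>. g \<alpha> \<noteq> 0}" by auto
  moreover have "finite ({\<alpha>. f \<alpha> \<noteq> 0} \<union> {\<alpha>. g \<alpha> \<noteq> 0})" using assms by (auto simp: mpols_def)
  ultimately have "finite {\<alpha>. f \<alpha> + g \<alpha> \<noteq> 0}" by (rule finite_subset)
  moreover have "f \<alpha> + g \<alpha> \<noteq> 0 \<Longrightarrow> length \<alpha> = m" for \<alpha>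
    using assms unfolding mpols_def by (cases "f \<alpha> = 0") auto
  ultimately show ?thesis by (simp add: mpols_def)
qed

lemma mpols_smult:
  fixes f :: "nat list \<Rightarrow> 'b::mult_zero"
  shows "f \<in> mpols m \<Longrightarrow> (\<lambda>\<alpha>. q * f \<alpha>) \<in> mpols m"
  by (erule mpols_subsupport) auto

definition spec :: "'a::field \<Rightarrow> (nat list \<Rightarrow> 'a poly) \<Rightarrow> nat list \<Rightarrow> 'a" where
  "spec c G = (\<lambda>\<alpha>. poly (G \<alpha>) c)"

lemma spec_mpols: "G \<in> mpols m \<Longrightarrow> spec c G \<in> mpols m"
  unfolding spec_def by (erule mpols_subsupport) auto

definition mon :: "nat list \<Rightarrow> 'a::field list \<Rightarrow> 'a" where
  "mon \<alpha> a = (\<Prod>i<length a. (a ! i) ^ (\<alpha> ! i))"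

lemma mp_eval_sum:
  assumes "finite S" "{\<alpha>. f \<alpha> \<noteq> 0} \<subseteq> S"
  shows "mp_eval f a = (\<Sum>\<alpha>\<in>S. f \<alpha> * mon \<alpha> a)"
  unfolding mp_eval_def mon_def using assms by (intro sum.mono_neutral_left) auto

lemma mp_eval_add:
  assumes "f \<in> mpols m" "g \<in> mpols m"
  shows "mp_eval (\<lambda>\<alpha>. f \<alpha> + g \<alpha>) a = mp_eval f a + mp_eval g a"
proof -
  let ?S = "{\<alpha>. f \<alpha> \<noteq> 0} \<union> {\<alpha>. g \<alpha> \<noteq> 0}"
  have fin: "finite ?S" using assms by (auto simp: mpols_def)
  have 1: "mp_eval f a = (\<Sum>\<alpha>\<in>?S. f \<alpha> * mon \<alpha> a)" by (rule mp_eval_sum[OF fin]) auto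
  have 2: "mp_eval g a = (\<Sum>\<alpha>\<in>?S. g \<alpha> * mon \<alpha> a)" by (rule mp_eval_sum[OF fin]) auto
  have 3: "mp_eval (\<lambda>\<alpha>. f \<alpha> + g \<alpha>) a = (\<Sum>\<alpha>\<in>?S. (f \<alpha> + g \<alpha>) * mon \<alpha> a)"
    by (rule mp_eval_sum[OF fin]) auto
  show ?thesis unfolding 1 2 3 by (simp add: sum.distrib distrib_right)
qed

lemma mp_eval_smult:
  assumes "f \<in> mpols m"
  shows "mp_eval (\<lambda>\<alpha>. q * f \<alpha>) a = q * mp_eval f a"
proof -
  let ?S = "{\<alpha>. f \<alpha> \<noteq> 0}"
  have fin: "finite ?S" using assms by (auto simp: mpols_def)
  have 1: "mp_eval f a = (\<Sum>\<alpha>\<in>?S. f \<alpha> * mon \<alpha> a)" by (rule mp_eval_sum[OF fin]) auto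
  have 3: "mp_eval (\<lambda>\<alpha>. q * f \<alpha>) a = (\<Sum>\<alpha>\<in>?S. (q * f \<alpha>) * mon \<alpha> a)"
    by (rule mp_eval_sum[OF fin]) auto
  show ?thesis unfolding 1 3 by (simp add: sum_distrib_left mult.assoc)
qed

lemma eval_spec_add:
  assumes "F \<in> mpols m" "G \<in> mpols m"
  shows "mp_eval (spec c (\<lambda>\<alpha>. F \<alpha> + G \<alpha>)) a = mp_eval (spec c F) a + mp_eval (spec c G) a"
  using mp_eval_add[OF spec_mpols[OF assms(1)] spec_mpols[OF assms(2)]] by (simp add: spec_def)

lemma eval_spec_smult:
  assumes "F \<in> mpols m"
  shows "mp_eval (spec c (\<lambda>\<alpha>. q * F \<alpha>)) a = poly q c * mp_eval (spec c F) a"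
  using mp_eval_smult[OF spec_mpols[OF assms]] by (simp add: spec_def)

section \<open>Multiplication by monomials\<close>

lemma length_add_exp [simp]: "length (add_exp \<alpha> \<beta>) = min (length \<alpha>) (length \<beta>)"
  by (simp add: add_exp_def)

lemma nth_add_exp: "i < length \<alpha> \<Longrightarrow> i < length \<beta> \<Longrightarrow> add_exp \<alpha> \<beta> ! i = \<alpha> ! i + \<beta> ! i"
  by (simp add: add_exp_def)

lemma add_exp_Cons: "add_exp (s # \<alpha>) (t # \<beta>) = (s + t) # add_exp \<alpha> \<beta>"
  by (simp add: add_exp_def)

lemma add_exp_left_inject:
  assumes "add_exp \<epsilon> \<alpha> = add_exp \<epsilon> \<beta>" "length \<alpha> = length \<epsilon>" "length \<beta> = length \<epsilon>"
  shows "\<alpha> = \<beta>"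
proof (rule nth_equalityI)
  show "length \<alpha> = length \<beta>" using assms by simp
  fix i assume "i < length \<alpha>"
  then have "add_exp \<epsilon> \<alpha> ! i = \<epsilon> ! i + \<alpha> ! i" "add_exp \<epsilon> \<beta> ! i = \<epsilon> ! i + \<beta> ! i"
    using assms(2,3) by (simp_all add: nth_add_exp)
  with assms(1) show "\<alpha> ! i = \<beta> ! i" by simp
qed

text \<open>This is multiplication by the monomial X^\<epsilon>. A general product of coefficient
  functions is never formed: sums, scalar multiples and shifts generate all multiples. The length
  condition makes the quotient exponent unique, because \<open>add_exp\<close> truncates to the
  shorter list.\<close>

definition shift :: "nat list \<Rightarrow> (nat list \<Rightarrow> 'b::zero) \<Rightarrow> nat list \<Rightarrow> 'b" where
  "shift \<epsilon> f \<alpha> = (if \<exists>\<gamma>. length \<gamma> = length \<epsilon> \<and> \<alpha> = add_exp \<epsilon> \<gamma>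
     then f (THE \<gamma>. length \<gamma> = length \<epsilon> \<and> \<alpha> = add_exp \<epsilon> \<gamma>) else 0)"

lemma shift_add_exp:
  assumes "length \<gamma> = length \<epsilon>"
  shows "shift \<epsilon> f (add_exp \<epsilon> \<gamma>) = f \<gamma>"
proof -
  have "(THE \<gamma>'. length \<gamma>' = length \<epsilon> \<and> add_exp \<epsilon> \<gamma> = add_exp \<epsilon> \<gamma>') = \<gamma>"
    using assms add_exp_left_inject[of \<epsilon>] by (intro the_equality) auto
  with assms show ?thesis by (auto simp: shift_def)
qed

lemma shift_nonzeroE:
  assumes "shift \<epsilon> f \<alpha> \<noteq> 0"
  obtains \<gamma> where "length \<gamma> = length \<epsilon>" "\<alpha> = add_exp \<epsilon> \<gamma>" "f \<gamma> \<noteq> 0"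
proof -
  from assms obtain \<gamma> where "length \<gamma> = length \<epsilon>" "\<alpha> = add_exp \<epsilon> \<gamma>"
    by (auto simp: shift_def split: if_splits)
  with assms show ?thesis using that shift_add_exp by metis
qed

lemma shift_support:
  assumes "f \<in> mpols (length \<epsilon>)"
  shows "{\<alpha>. shift \<epsilon> f \<alpha> \<noteq> 0} = add_exp \<epsilon> ` {\<alpha>. f \<alpha> \<noteq> 0}"
  using assms by (auto elim!: shift_nonzeroE simp: shift_add_exp mpols_def)

lemma shift_mpols:
  assumes "f \<in> mpols m" "length \<epsilon> = m"
  shows "shift \<epsilon> f \<in> mpols m"
  using assms shift_support[of f \<epsilon>] unfolding mpols_def by (auto elim!: shift_nonzeroE)

lemma mon_add_exp:
  assumes "length \<epsilon> = length a" "length \<alpha> = length a"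
  shows "mon (add_exp \<epsilon> \<alpha>) a = mon \<epsilon> a * mon \<alpha> a"
  using assms by (simp add: mon_def nth_add_exp power_add prod.distrib)

lemma mp_eval_shift:
  assumes "f \<in> mpols m" "length \<epsilon> = m" "length a = m"
  shows "mp_eval (shift \<epsilon> f) a = mon \<epsilon> a * mp_eval f a"
proof -
  let ?S = "{\<alpha>. f \<alpha> \<noteq> 0}"
  have fin: "finite ?S" and len: "\<And>\<alpha>. \<alpha> \<in> ?S \<Longrightarrow> length \<alpha> = m"
    using assms by (auto simp: mpols_def)
  have inj: "inj_on (add_exp \<epsilon>) ?S"
    using len assms add_exp_left_inject[of \<epsilon>] by (intro inj_onI) metis
  have "mp_eval (shift \<epsilon> f) a = (\<Sum>\<alpha>\<in>add_exp \<epsilon> ` ?S. shift \<epsilon> f \<alpha> * mon \<alpha> a)"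
    using shift_support[of f \<epsilon>] assms fin by (intro mp_eval_sum) auto
  also have "\<dots> = (\<Sum>\<alpha>\<in>?S. shift \<epsilon> f (add_exp \<epsilon> \<alpha>) * mon (add_exp \<epsilon> \<alpha>) a)"
    by (simp add: sum.reindex[OF inj])
  also have "\<dots> = (\<Sum>\<alpha>\<in>?S. mon \<epsilon> a * (f \<alpha> * mon \<alpha> a))"
    using len assms by (intro sum.cong) (auto simp: shift_add_exp mon_add_exp)
  also have "\<dots> = mon \<epsilon> a * mp_eval f a"
    by (simp add: sum_distrib_left mp_eval_sum[OF fin])
  finally show ?thesis .
qed

lemma spec_shift: "spec c (shift \<epsilon> G) = shift \<epsilon> (spec c G)"
  unfolding spec_def shift_def by (rule ext) (simp only: if_distrib[of "\<lambda>p. poly p c"] poly_0)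

lemma eval_spec_shift:
  assumes "F \<in> mpols m" "length \<epsilon> = m" "length a = m"
  shows "mp_eval (spec c (shift \<epsilon> F)) a = mon \<epsilon> a * mp_eval (spec c F) a"
  unfolding spec_shift using mp_eval_shift[OF spec_mpols[OF assms(1)] assms(2,3)] .

section \<open>Separating the first variable\<close>

text \<open>The passage between k[X_1,...,X_n] and k[X_1][X'] is a relation between \<open>f\<close>
  and \<open>G\<close>, not a function, so the same lemma serves whether \<open>f\<close> is given
  and split or \<open>G\<close> is given and recombined.\<close>

lemma mp_eval_Cons:
  assumes f: "f \<in> mpols (Suc m)" and G: "\<And>\<gamma> t. coeff (G \<gamma>) t = f (t # \<gamma>)"
  shows "mp_eval f (c # a) = mp_eval (spec c G) a" and "G \<in> mpols m"
proof -
  let ?S = "{\<alpha>. f \<alpha> \<noteq> 0}"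
  let ?T = "tl ` ?S"
  have fin: "finite ?S" and len: "\<And>\<alpha>. \<alpha> \<in> ?S \<Longrightarrow> length \<alpha> = Suc m"
    using f by (auto simp: mpols_def)
  have finT: "finite ?T" using fin by simp
  \<comment> \<open>A bound on the X_1-degree lets the sum run over a full rectangle of pairs, where
    the order of summation can be exchanged. For empty support its value is arbitrary and the bound
    is vacuous.\<close>
  define N where "N = Max (hd ` ?S)"
  have N: "hd \<alpha> \<le> N" if "\<alpha> \<in> ?S" for \<alpha>
    unfolding N_def using fin that by (intro Max_ge) auto
  have suppG: "{\<gamma>. G \<gamma> \<noteq> 0} \<subseteq> ?T"
  proof
    fix \<gamma> assume "\<gamma> \<in> {\<gamma>. G \<gamma> \<noteq> 0}"
    then obtain t where "coeff (G \<gamma>) t \<noteq> 0" by (auto simp: poly_eq_iff)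
    then have "t # \<gamma> \<in> ?S" by (simp add: G)
    then show "\<gamma> \<in> ?T" by (metis image_eqI list.sel(3))
  qed
  have lenT: "\<And>\<gamma>. \<gamma> \<in> ?T \<Longrightarrow> length \<gamma> = m" using len by fastforce
  show "G \<in> mpols m"
    unfolding mpols_def using suppG finT lenT by (auto dest: finite_subset)
  have pG: "poly (G \<gamma>) c = (\<Sum>t\<le>N. f (t # \<gamma>) * c ^ t)" for \<gamma>
  proof -
    have "t \<le> N" if "coeff (G \<gamma>) t \<noteq> 0" for t
      using N[of "t # \<gamma>"] that by (simp add: G)
    then have "degree (G \<gamma>) \<le> N" by (cases "G \<gamma> = 0") auto
    then show ?thesis
      unfolding poly_altdef G[symmetric]
      by (intro sum.mono_neutral_left) (auto simp: coeff_eq_0)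
  qed
  let ?P = "(\<lambda>(t,\<gamma>). t # \<gamma>) ` ({..N} \<times> ?T)"
  have inj: "inj_on (\<lambda>(t,\<gamma>). t # \<gamma>) ({..N} \<times> ?T)" by (auto simp: inj_on_def)
  have sub: "?S \<subseteq> ?P"
  proof
    fix \<alpha> assume a: "\<alpha> \<in> ?S"
    with len obtain t \<gamma> where "\<alpha> = t # \<gamma>" by (metis length_Suc_conv)
    with a N[OF a] show "\<alpha> \<in> ?P" by (force simp: image_iff)
  qed
  have "mp_eval f (c # a) = (\<Sum>\<alpha>\<in>?P. f \<alpha> * mon \<alpha> (c # a))"
    using sub finT by (intro mp_eval_sum) auto
  also have "\<dots> = (\<Sum>(t,\<gamma>)\<in>{..N} \<times> ?T. f (t # \<gamma>) * mon (t # \<gamma>) (c # a))"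
    by (subst sum.reindex[OF inj]) (simp add: case_prod_beta o_def)
  also have "\<dots> = (\<Sum>t\<le>N. \<Sum>\<gamma>\<in>?T. f (t # \<gamma>) * mon (t # \<gamma>) (c # a))"
    by (simp add: sum.cartesian_product)
  also have "\<dots> = (\<Sum>\<gamma>\<in>?T. \<Sum>t\<le>N. f (t # \<gamma>) * mon (t # \<gamma>) (c # a))"
    by (rule sum.swap)
  also have "\<dots> = (\<Sum>\<gamma>\<in>?T. spec c G \<gamma> * mon \<gamma> a)"
    by (simp add: spec_def pG mon_def prod.lessThan_Suc_shift sum_distrib_right mult.assoc
        del: prod.lessThan_Suc)
  also have "\<dots> = mp_eval (spec c G) a"
    using suppG finT by (intro mp_eval_sum[symmetric]) (auto simp: spec_def)
  finally show "mp_eval f (c # a) = mp_eval (spec c G) a" .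
qed

lemma separate_first_variable:
  assumes "f \<in> mpols (Suc m)"
  obtains G where "\<And>\<gamma> t. coeff (G \<gamma>) t = f (t # \<gamma>)"
proof
  fix \<gamma> t
  have "finite {t. f (t # \<gamma>) \<noteq> 0}"
    using assms finite_vimageI[of "{\<alpha>. f \<alpha> \<noteq> 0}" "\<lambda>t. t # \<gamma>"]
    by (auto simp: mpols_def vimage_def inj_on_def)
  then have "(\<lambda>t. f (t # \<gamma>)) \<in> {g. \<forall>\<^sub>\<infinity>n. g n = 0}" by (simp add: eventually_cofinite)
  then show "coeff ((\<lambda>\<gamma>. Abs_poly (\<lambda>t. f (t # \<gamma>))) \<gamma>) t = f (t # \<gamma>)"
    by (simp add: Abs_poly_inverse)
qed

lemma combine_first_variable:
  assumes "G \<in> mpols m"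
  obtains f where "f \<in> mpols (Suc m)" "\<And>\<gamma> t. coeff (G \<gamma>) t = f (t # \<gamma>)"
proof
  let ?f = "\<lambda>\<alpha>. case \<alpha> of [] \<Rightarrow> 0 | t # \<gamma> \<Rightarrow> coeff (G \<gamma>) t"
  have "{\<alpha>. ?f \<alpha> \<noteq> 0} \<subseteq> (\<Union>\<gamma>\<in>{\<gamma>. G \<gamma> \<noteq> 0}. (\<lambda>t. t # \<gamma>) ` {..degree (G \<gamma>)})"
  proof
    fix \<alpha> assume a: "\<alpha> \<in> {\<alpha>. ?f \<alpha> \<noteq> 0}"
    then obtain t \<gamma> where "\<alpha> = t # \<gamma>" "coeff (G \<gamma>) t \<noteq> 0" by (cases \<alpha>) auto
    then show "\<alpha> \<in> (\<Union>\<gamma>\<in>{\<gamma>. G \<gamma> \<noteq> 0}. (\<lambda>t. t # \<gamma>) ` {..degree (G \<gamma>)})"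
      by (intro UN_I[of \<gamma>]) (auto simp: le_degree)
  qed
  then have "finite {\<alpha>. ?f \<alpha> \<noteq> 0}"
    by (rule finite_subset) (use assms in \<open>auto simp: mpols_def\<close>)
  moreover have "length \<alpha> = Suc m" if "?f \<alpha> \<noteq> 0" for \<alpha>
  proof (cases \<alpha>)
    case (Cons t \<gamma>)
    with that have "G \<gamma> \<noteq> 0" by auto
    with assms Cons show ?thesis by (simp add: mpols_def)
  qed (use that in simp)
  ultimately show "?f \<in> mpols (Suc m)" by (simp add: mpols_def)
qed simp

text \<open>Fixing all variables but X_1 leaves a univariate polynomial with infinitely many zeros.
  Its coefficients are the X_1-slices of \<open>f\<close> evaluated at the fixed point, so every
  slice is again a polynomial vanishing everywhere, in one variable less.\<close>

lemma mp_eval_eq_0_imp: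
  fixes f :: "nat list \<Rightarrow> 'a::field"
  assumes "infinite (UNIV :: 'a set)" "f \<in> mpols m" "\<And>a. length a = m \<Longrightarrow> mp_eval f a = 0"
  shows "f = (\<lambda>_. 0)"
  using assms(2,3)
proof (induction m arbitrary: f)
  case 0
  have "{\<alpha>. f \<alpha> \<noteq> 0} \<subseteq> {[]}" using 0 by (auto simp: mpols_def)
  then have "mp_eval f [] = f []" by (subst mp_eval_sum[of "{[]}"]) (auto simp: mon_def)
  with 0 have "f [] = 0" by simp
  with \<open>{\<alpha>. f \<alpha> \<noteq> 0} \<subseteq> {[]}\<close> show ?case by auto
next
  case (Suc m)
  obtain G where G: "\<And>\<gamma> t. coeff (G \<gamma>) t = f (t # \<gamma>)"
    using separate_first_variable[OF Suc.prems(1)] by metis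
  have Gm: "G \<in> mpols m" by (rule mp_eval_Cons(2)[OF Suc.prems(1) G])
  let ?T = "{\<gamma>. G \<gamma> \<noteq> 0}"
  have fin: "finite ?T" using Gm by (simp add: mpols_def)
  have "(\<lambda>\<gamma>. coeff (G \<gamma>) t) = (\<lambda>_. 0)" for t
  proof (rule Suc.IH)
    show "(\<lambda>\<gamma>. coeff (G \<gamma>) t) \<in> mpols m" by (rule mpols_subsupport[OF Gm]) simp
    fix a :: "'a list" assume a: "length a = m"
    define q where "q = (\<Sum>\<gamma>\<in>?T. smult (mon \<gamma> a) (G \<gamma>))"
    have "poly q c = 0" for c
    proof -
      have "poly q c = mp_eval (spec c G) a"
        unfolding q_def using fin
        by (subst mp_eval_sum[of ?T]) (auto simp: poly_sum spec_def mult.commute)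
      also have "\<dots> = mp_eval f (c # a)"
        by (rule mp_eval_Cons(1)[OF Suc.prems(1) G, symmetric])
      also have "\<dots> = 0" using Suc.prems(2) a by simp
      finally show ?thesis .
    qed
    then have "q = 0" using poly_roots_finite[of q] assms(1) by auto
    have "mp_eval (\<lambda>\<gamma>. coeff (G \<gamma>) t) a = (\<Sum>\<gamma>\<in>?T. coeff (G \<gamma>) t * mon \<gamma> a)"
      using fin by (intro mp_eval_sum) auto
    also have "\<dots> = coeff q t"
      by (simp add: q_def coeff_sum mult.commute)
    finally show "mp_eval (\<lambda>\<gamma>. coeff (G \<gamma>) t) a = 0" using \<open>q = 0\<close> by simp
  qed
  then have "f (t # \<gamma>) = 0" for t \<gamma> by (metis G)
  moreover have "f [] = 0" using Suc.prems(1) by (auto simp: mpols_def)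
  ultimately show ?case by (metis neq_Nil_conv)
qed

section \<open>Dickson's lemma\<close>

text \<open>Induction on the number of coordinates: finitely many elements of \<open>S\<close> have
  tails dividing all tails of \<open>S\<close>, and they divide everything at least as high as their
  largest first coordinate. Below that height only finitely many slices remain, each covered by the
  induction hypothesis.\<close>

lemma dickson:
  assumes "S \<subseteq> exps m"
  shows "\<exists>F\<subseteq>S. finite F \<and> (\<forall>s\<in>S. \<exists>\<sigma>\<in>F. \<exists>\<epsilon>\<in>exps m. s = add_exp \<epsilon> \<sigma>)"
  using assms
proof (induction m arbitrary: S)
  case 0
  then show ?case by (intro exI[of _ S]) (auto simp: exps_def add_exp_def intro: finite_subset[of _ "{[]}"])
next
  case (Suc m)
  define D where "D F S \<longleftrightarrow> F \<subseteq> S \<and> finite F \<and> (\<forall>s\<in>S. \<exists>\<sigma>\<in>F. \<exists>\<epsilon>\<in>exps m. s = add_exp \<epsilon> \<sigma>)" for F S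
  have IH: "\<exists>F. D F S" if "S \<subseteq> exps m" for S using Suc.IH[OF that] by (simp add: D_def)
  have shape: "\<exists>t \<gamma>. s = t # \<gamma> \<and> \<gamma> \<in> exps m" if "s \<in> S" for s
    using that Suc.prems by (cases s) (auto simp: exps_def)
  have "tl ` S \<subseteq> exps m" using Suc.prems by (auto simp: exps_def)
  then obtain F0 where F0: "D F0 (tl ` S)" using IH by blast
  then have "\<forall>\<gamma>\<in>F0. \<exists>t. t # \<gamma> \<in> S" using shape by (fastforce simp: D_def)
  then obtain h where h: "\<And>\<gamma>. \<gamma> \<in> F0 \<Longrightarrow> h \<gamma> # \<gamma> \<in> S" by metis
  \<comment> \<open>The inserted 0 keeps the maximum meaningful when \<open>F0\<close> is
    empty.\<close>
  define N where "N = Max (insert 0 (h ` F0))"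
  have N: "h \<gamma> \<le> N" if "\<gamma> \<in> F0" for \<gamma>
    using that F0 by (auto simp: N_def D_def)
  have "\<exists>F. D F {\<gamma>. t # \<gamma> \<in> S}" for t
    using Suc.prems by (intro IH) (auto simp: exps_def)
  then obtain E where E: "\<And>t. D (E t) {\<gamma>. t # \<gamma> \<in> S}" by metis
  define F where "F = (\<lambda>\<gamma>. h \<gamma> # \<gamma>) ` F0 \<union> (\<Union>t\<le>N. (#) t ` E t)"
  have "F \<subseteq> S" using h E by (auto simp: F_def D_def)
  moreover have "finite F" using F0 E by (auto simp: F_def D_def)
  moreover have "\<exists>\<sigma>\<in>F. \<exists>\<epsilon>\<in>exps (Suc m). s = add_exp \<epsilon> \<sigma>" if s: "s \<in> S" for s
  proof -
    obtain t \<gamma> where t: "s = t # \<gamma>" "\<gamma> \<in> exps m" using shape[OF s] by blast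
    show ?thesis
    proof (cases "t \<le> N")
      case True
      obtain \<sigma> \<epsilon> where "\<sigma> \<in> E t" "\<epsilon> \<in> exps m" "\<gamma> = add_exp \<epsilon> \<sigma>"
        using E[of t] s t by (auto simp: D_def)
      with True t show ?thesis
        by (intro bexI[of _ "t # \<sigma>"] bexI[of _ "0 # \<epsilon>"])
           (auto simp: F_def add_exp_Cons exps_def)
    next
      case False
      have "\<gamma> \<in> tl ` S" using s t by force
      then obtain \<sigma> \<epsilon> where *: "\<sigma> \<in> F0" "\<epsilon> \<in> exps m" "\<gamma> = add_exp \<epsilon> \<sigma>"
        using F0 by (auto simp: D_def)
      with False N[of \<sigma>] t show ?thesis
        by (intro bexI[of _ "h \<sigma> # \<sigma>"] bexI[of _ "(t - h \<sigma>) # \<epsilon>"])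
           (auto simp: F_def add_exp_Cons exps_def)
    qed
  qed
  ultimately show ?case by blast
qed

section \<open>Leading exponents and generic specialization\<close>

text \<open>A relational form of \<open>lead_exp\<close>, usable for coefficients in k and in k[X_1]
  alike and free of definite description.\<close>

definition is_lead :: "(nat list \<Rightarrow> nat list \<Rightarrow> bool) \<Rightarrow> (nat list \<Rightarrow> 'b::zero) \<Rightarrow> nat list \<Rightarrow> bool" where
  "is_lead lt f \<alpha> \<longleftrightarrow> f \<alpha> \<noteq> 0 \<and> (\<forall>\<beta>. f \<beta> \<noteq> 0 \<longrightarrow> \<beta> \<noteq> \<alpha> \<longrightarrow> lt \<beta> \<alpha>)"

text \<open>The nonempty sets of this kind are the ideals of k[X_1][X']: multiplying by an arbitrary
  element amounts to summing k[X_1]-multiples of shifts.\<close>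

definition submodule :: "nat \<Rightarrow> (nat list \<Rightarrow> 'a::field poly) set \<Rightarrow> bool" where
  "submodule m I \<longleftrightarrow> I \<subseteq> mpols m \<and> (\<forall>F\<in>I. \<forall>G\<in>I. (\<lambda>\<alpha>. F \<alpha> + G \<alpha>) \<in> I) \<and>
     (\<forall>F\<in>I. \<forall>q. (\<lambda>\<alpha>. q * F \<alpha>) \<in> I) \<and> (\<forall>F\<in>I. \<forall>\<epsilon>\<in>exps m. shift \<epsilon> F \<in> I)"

lemma submoduleD:
  assumes "submodule m I"
  shows "F \<in> I \<Longrightarrow> F \<in> mpols m"
    and "F \<in> I \<Longrightarrow> G \<in> I \<Longrightarrow> (\<lambda>\<alpha>. F \<alpha> + G \<alpha>) \<in> I"
    and "F \<in> I \<Longrightarrow> (\<lambda>\<alpha>. q * F \<alpha>) \<in> I"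
    and "F \<in> I \<Longrightarrow> \<epsilon> \<in> exps m \<Longrightarrow> shift \<epsilon> F \<in> I"
  using assms by (auto simp: submodule_def)

lemma shift_smult: "shift \<epsilon> (\<lambda>\<alpha>. q * G \<alpha>) = (\<lambda>\<alpha>. q * shift \<epsilon> G \<alpha>)"
  for q :: "'b::mult_zero"
  unfolding shift_def by (rule ext) (simp only: if_distrib[of "\<lambda>x. q * x"] mult_zero_right)

lemma shift_add: "shift \<epsilon> (\<lambda>\<alpha>. F \<alpha> + G \<alpha>) = (\<lambda>\<alpha>. shift \<epsilon> F \<alpha> + shift \<epsilon> G \<alpha>)"
  for F :: "nat list \<Rightarrow> 'b::monoid_add"
proof
  fix \<alpha>
  show "shift \<epsilon> (\<lambda>\<alpha>. F \<alpha> + G \<alpha>) \<alpha> = shift \<epsilon> F \<alpha> + shift \<epsilon> G \<alpha>"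
  proof (cases "\<exists>\<gamma>. length \<gamma> = length \<epsilon> \<and> \<alpha> = add_exp \<epsilon> \<gamma>")
    case True
    then show ?thesis by (auto simp: shift_add_exp)
  next
    case False
    then show ?thesis unfolding shift_def by (simp only: if_False add_0)
  qed
qed

text \<open>Used both for the given order in n variables and for its restriction to the last n - 1.
  Monotonicity adds \<epsilon> on the left to match \<open>shift\<close>.\<close>

locale monomial_order =
  fixes m :: nat and lt :: "nat list \<Rightarrow> nat list \<Rightarrow> bool"
  assumes irrefl: "\<alpha> \<in> exps m \<Longrightarrow> \<not> lt \<alpha> \<alpha>"
    and trans: "\<alpha> \<in> exps m \<Longrightarrow> \<beta> \<in> exps m \<Longrightarrow> \<gamma> \<in> exps m \<Longrightarrow> lt \<alpha> \<beta> \<Longrightarrow> lt \<beta> \<gamma> \<Longrightarrow> lt \<alpha> \<gamma>"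
    and total: "\<alpha> \<in> exps m \<Longrightarrow> \<beta> \<in> exps m \<Longrightarrow> \<alpha> \<noteq> \<beta> \<Longrightarrow> lt \<alpha> \<beta> \<or> lt \<beta> \<alpha>"
    and wf: "wf {(\<alpha>, \<beta>). \<alpha> \<in> exps m \<and> \<beta> \<in> exps m \<and> lt \<alpha> \<beta>}"
    and add_mono: "\<alpha> \<in> exps m \<Longrightarrow> \<beta> \<in> exps m \<Longrightarrow> \<epsilon> \<in> exps m \<Longrightarrow> lt \<alpha> \<beta> \<Longrightarrow>
      lt (add_exp \<epsilon> \<alpha>) (add_exp \<epsilon> \<beta>)"
begin

lemma ex_maximum:
  assumes "finite S" "S \<noteq> {}" "S \<subseteq> exps m"
  shows "\<exists>\<alpha>\<in>S. \<forall>\<beta>\<in>S. \<beta> \<noteq> \<alpha> \<longrightarrow> lt \<beta> \<alpha>"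
  using assms
proof (induction rule: finite_ne_induct)
  case (insert x S)
  then obtain \<alpha> where \<alpha>: "\<alpha> \<in> S" "\<forall>\<beta>\<in>S. \<beta> \<noteq> \<alpha> \<longrightarrow> lt \<beta> \<alpha>" by auto
  have ex: "x \<in> exps m" "\<alpha> \<in> exps m" "x \<noteq> \<alpha>" "S \<subseteq> exps m" using insert \<alpha> by auto
  then consider "lt x \<alpha>" | "lt \<alpha> x" using total by blast
  then show ?case
  proof cases
    case 1
    with \<alpha> show ?thesis by auto
  next
    case 2
    have "lt \<beta> x" if "\<beta> \<in> S" for \<beta>
      using that 2 \<alpha> ex trans[of \<beta> \<alpha> x] by (cases "\<beta> = \<alpha>") auto
    then show ?thesis by auto
  qed
qed auto

lemma mpols_exps: "f \<in> mpols m \<Longrightarrow> f \<alpha> \<noteq> 0 \<Longrightarrow> \<alpha> \<in> exps m"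
  by (simp add: mpols_def exps_def)

lemma ex_lead:
  assumes "f \<in> mpols m" "f \<noteq> (\<lambda>_. 0)"
  shows "\<exists>\<alpha>. is_lead lt f \<alpha>"
  using ex_maximum[of "{\<alpha>. f \<alpha> \<noteq> 0}"] assms
  by (auto simp: is_lead_def mpols_def exps_def fun_eq_iff)

lemma lead_exp_eq:
  assumes f: "f \<in> mpols m" "is_lead lt f \<alpha>"
  shows "lead_exp lt f = \<alpha>"
  unfolding lead_exp_def
proof (rule the_equality)
  show "f \<alpha> \<noteq> 0 \<and> (\<forall>\<beta>. f \<beta> \<noteq> 0 \<longrightarrow> \<beta> \<noteq> \<alpha> \<longrightarrow> lt \<beta> \<alpha>)" using f by (simp add: is_lead_def)
  fix \<gamma> assume \<gamma>: "f \<gamma> \<noteq> 0 \<and> (\<forall>\<beta>. f \<beta> \<noteq> 0 \<longrightarrow> \<beta> \<noteq> \<gamma> \<longrightarrow> lt \<beta> \<gamma>)"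
  have "\<alpha> \<in> exps m" "\<gamma> \<in> exps m" using f \<gamma> by (auto simp: is_lead_def mpols_exps)
  with f \<gamma> show "\<gamma> = \<alpha>" unfolding is_lead_def using irrefl trans by metis
qed

text \<open>Leading coefficients in k[X_1] cannot be divided by, so the two leading terms are
  cancelled by cross-multiplication. The difference is written with \<open>+ -\<close> so that
  closure of a submodule under sums and scalar multiples applies to it literally.\<close>

lemma pseudo_reduction:
  fixes F g :: "nat list \<Rightarrow> 'b::comm_ring_1"
  assumes F: "F \<in> mpols m" "is_lead lt F (add_exp \<epsilon> \<sigma>)"
    and g: "g \<in> mpols m" "is_lead lt g \<sigma>" and \<epsilon>: "\<epsilon> \<in> exps m"
    and nz: "g \<sigma> * F \<alpha> + - F (add_exp \<epsilon> \<sigma>) * shift \<epsilon> g \<alpha> \<noteq> 0"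
  shows "lt \<alpha> (add_exp \<epsilon> \<sigma>)"
proof -
  have \<sigma>: "\<sigma> \<in> exps m" using g by (auto simp: is_lead_def mpols_exps)
  have sh: "shift \<epsilon> g (add_exp \<epsilon> \<sigma>) = g \<sigma>"
    using \<sigma> \<epsilon> by (intro shift_add_exp) (simp add: exps_def)
  have ne: "\<alpha> \<noteq> add_exp \<epsilon> \<sigma>" using nz sh by (auto simp: mult.commute)
  show ?thesis
  proof (cases "F \<alpha> = 0")
    case False
    with F ne show ?thesis by (simp add: is_lead_def)
  next
    case True
    with nz have "shift \<epsilon> g \<alpha> \<noteq> 0" by auto
    then obtain \<gamma> where \<gamma>: "\<alpha> = add_exp \<epsilon> \<gamma>" "g \<gamma> \<noteq> 0" by (rule shift_nonzeroE)
    with ne g have "lt \<gamma> \<sigma>" by (auto simp: is_lead_def)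
    with \<gamma> \<sigma> \<epsilon> g show ?thesis using add_mono mpols_exps by metis
  qed
qed

text \<open>By Dickson's lemma finitely many elements of \<open>I\<close> suffice to divide all leading exponents, so
  their leading coefficients and the associated witnesses \<open>b\<close> vanish simultaneously off the zeros of
  a single nonzero polynomial.\<close>

lemma generic_leading_divisors:
  fixes I :: "(nat list \<Rightarrow> 'a::field poly) set"
  assumes I: "I \<subseteq> mpols m" and Q: "\<forall>g\<in>I. \<exists>b. b \<noteq> 0 \<and> Q g b"
  obtains h :: "'a poly" where "h \<noteq> 0"
    "\<And>c G \<gamma>. poly h c \<noteq> 0 \<Longrightarrow> G \<in> I \<Longrightarrow> is_lead lt G \<gamma> \<Longrightarrow>
      \<exists>g\<in>I. \<exists>\<sigma> \<epsilon> b. \<epsilon> \<in> exps m \<and> is_lead lt g \<sigma> \<and> \<gamma> = add_exp \<epsilon> \<sigma> \<and>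
        poly (g \<sigma>) c \<noteq> 0 \<and> Q g b \<and> poly b c \<noteq> 0"
proof -
  let ?S = "{\<gamma>. \<exists>G\<in>I. is_lead lt G \<gamma>}"
  have "?S \<subseteq> exps m" using I by (auto simp: is_lead_def intro: mpols_exps)
  then obtain E where E: "E \<subseteq> ?S" "finite E"
    "\<forall>s\<in>?S. \<exists>\<sigma>\<in>E. \<exists>\<epsilon>\<in>exps m. s = add_exp \<epsilon> \<sigma>"
    by (metis (no_types, lifting) dickson)
  then have "\<forall>\<sigma>\<in>E. \<exists>g b. g \<in> I \<and> is_lead lt g \<sigma> \<and> b \<noteq> 0 \<and> Q g b" using Q by blast
  then obtain g b where gb: "\<And>\<sigma>. \<sigma> \<in> E \<Longrightarrow> g \<sigma> \<in> I \<and> is_lead lt (g \<sigma>) \<sigma> \<and> b \<sigma> \<noteq> 0 \<and> Q (g \<sigma>) (b \<sigma>)"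
    by metis
  define h where "h = (\<Prod>\<sigma>\<in>E. g \<sigma> \<sigma> * b \<sigma>)"
  show thesis
  proof
    show "h \<noteq> 0" using E(2) gb by (auto simp: h_def is_lead_def)
    fix c G \<gamma> assume c: "poly h c \<noteq> 0" and G: "G \<in> I" "is_lead lt G \<gamma>"
    then obtain \<sigma> \<epsilon> where s: "\<sigma> \<in> E" "\<epsilon> \<in> exps m" "\<gamma> = add_exp \<epsilon> \<sigma>" using E(3) by blast
    have "poly (g \<sigma> \<sigma>) c \<noteq> 0 \<and> poly (b \<sigma>) c \<noteq> 0"
      using c s(1) E(2) by (auto simp: h_def poly_prod)
    with s gb show "\<exists>g\<in>I. \<exists>\<sigma> \<epsilon> b. \<epsilon> \<in> exps m \<and> is_lead lt g \<sigma> \<and> \<gamma> = add_exp \<epsilon> \<sigma> \<and>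
        poly (g \<sigma>) c \<noteq> 0 \<and> Q g b \<and> poly b c \<noteq> 0" by blast
  qed
qed

lemma lead_induct [consumes 1, case_names less]:
  assumes "\<gamma> \<in> exps m"
    and "\<And>\<gamma>. \<gamma> \<in> exps m \<Longrightarrow> (\<And>\<gamma>'. \<gamma>' \<in> exps m \<Longrightarrow> lt \<gamma>' \<gamma> \<Longrightarrow> P \<gamma>') \<Longrightarrow> P \<gamma>"
  shows "P \<gamma>"
  using wf assms(1) by (induction \<gamma> rule: wf_induct_rule) (use assms(2) in auto)

text \<open>The elements annihilated modulo \<aa> by some nonzero polynomial in X_1 form a submodule
  \<open>T\<close>. If the finitely many chosen divisors of \<open>T\<close> have leading
  coefficients and annihilators not vanishing at \<open>c\<close>, pseudo-division gives every
  element of \<open>T\<close> an annihilator \<open>q\<close> with q(c) nonzero. An element killed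
  by X_1 - c is then also killed by a polynomial coprime to X_1 - c, hence lies in \<aa>.\<close>

lemma generic_torsion_free:
  fixes \<aa> :: "(nat list \<Rightarrow> 'a::field poly) set"
  assumes \<aa>: "submodule m \<aa>"
  obtains h :: "'a poly" where "h \<noteq> 0"
    "\<And>c G. poly h c \<noteq> 0 \<Longrightarrow> G \<in> mpols m \<Longrightarrow> (\<lambda>\<alpha>. [:-c, 1:] * G \<alpha>) \<in> \<aa> \<Longrightarrow> G \<in> \<aa>"
proof -
  define T where "T = {G \<in> mpols m. \<exists>b. b \<noteq> 0 \<and> (\<lambda>\<alpha>. b * G \<alpha>) \<in> \<aa>}"
  have T_add: "(\<lambda>\<alpha>. F \<alpha> + G \<alpha>) \<in> T" if FG: "F \<in> T" "G \<in> T" for F G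
  proof -
    obtain b1 b2 where b: "b1 \<noteq> 0" "(\<lambda>\<alpha>. b1 * F \<alpha>) \<in> \<aa>" "b2 \<noteq> 0" "(\<lambda>\<alpha>. b2 * G \<alpha>) \<in> \<aa>"
      using FG by (auto simp: T_def)
    have "(\<lambda>\<alpha>. b2 * (b1 * F \<alpha>) + b1 * (b2 * G \<alpha>)) \<in> \<aa>" by (fact | rule submoduleD[OF \<aa>])+
    then have "(\<lambda>\<alpha>. (b1 * b2) * (F \<alpha> + G \<alpha>)) \<in> \<aa>" by (simp add: algebra_simps)
    moreover have "(\<lambda>\<alpha>. F \<alpha> + G \<alpha>) \<in> mpols m"
      using FG by (intro mpols_add) (simp_all add: T_def)
    moreover have "b1 * b2 \<noteq> 0" using b by simp
    ultimately show ?thesis unfolding T_def by blast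
  qed
  have T_smult: "(\<lambda>\<alpha>. q * G \<alpha>) \<in> T" if G: "G \<in> T" for q G
  proof -
    obtain b where b: "b \<noteq> 0" "(\<lambda>\<alpha>. b * G \<alpha>) \<in> \<aa>" using G by (auto simp: T_def)
    have "(\<lambda>\<alpha>. q * (b * G \<alpha>)) \<in> \<aa>" by (fact | rule submoduleD[OF \<aa>])+
    then have "(\<lambda>\<alpha>. b * (q * G \<alpha>)) \<in> \<aa>" by (simp add: mult.left_commute)
    moreover have "(\<lambda>\<alpha>. q * G \<alpha>) \<in> mpols m"
      using G by (intro mpols_smult) (simp add: T_def)
    ultimately show ?thesis unfolding T_def using b(1) by blast
  qed
  have T_shift: "shift \<epsilon> G \<in> T" if G: "G \<in> T" "\<epsilon> \<in> exps m" for \<epsilon> G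
  proof -
    obtain b where b: "b \<noteq> 0" "(\<lambda>\<alpha>. b * G \<alpha>) \<in> \<aa>" using G by (auto simp: T_def)
    have "shift \<epsilon> (\<lambda>\<alpha>. b * G \<alpha>) \<in> \<aa>" by (fact | rule submoduleD[OF \<aa>])+
    then have "(\<lambda>\<alpha>. b * shift \<epsilon> G \<alpha>) \<in> \<aa>" by (simp only: shift_smult)
    moreover have "shift \<epsilon> G \<in> mpols m"
      using G by (intro shift_mpols) (simp_all add: T_def exps_def)
    ultimately show ?thesis unfolding T_def using b(1) by blast
  qed
  have Tm: "T \<subseteq> mpols m" by (auto simp: T_def)
  have T_torsion: "\<forall>g\<in>T. \<exists>b. b \<noteq> 0 \<and> (\<lambda>\<alpha>. b * g \<alpha>) \<in> \<aa>"
    by (simp add: T_def)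
  obtain h where h: "h \<noteq> 0" "\<And>c G \<gamma>. poly h c \<noteq> 0 \<Longrightarrow> G \<in> T \<Longrightarrow> is_lead lt G \<gamma> \<Longrightarrow>
      \<exists>g\<in>T. \<exists>\<sigma> \<epsilon> b. \<epsilon> \<in> exps m \<and> is_lead lt g \<sigma> \<and> \<gamma> = add_exp \<epsilon> \<sigma> \<and>
        poly (g \<sigma>) c \<noteq> 0 \<and> (\<lambda>\<alpha>. b * g \<alpha>) \<in> \<aa> \<and> poly b c \<noteq> 0"
    using generic_leading_divisors[OF Tm T_torsion] by blast
  \<comment> \<open>\<open>submodule\<close> does not by itself put the zero function into \<aa>;
    here it lies there as the product of the zero element of \<open>T\<close> with its
    annihilator.\<close>
  have zero: "\<exists>q. poly q c \<noteq> 0 \<and> (\<lambda>\<alpha>. q * G \<alpha>) \<in> \<aa>" if "G \<in> T" "G = (\<lambda>_. 0)" for c G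
    using that by (intro exI[of _ 1]) (auto simp: T_def)
  have kill: "\<exists>q. poly q c \<noteq> 0 \<and> (\<lambda>\<alpha>. q * G \<alpha>) \<in> \<aa>"
    if c: "poly h c \<noteq> 0" and "\<gamma> \<in> exps m" "G \<in> T" "is_lead lt G \<gamma>" for c G \<gamma>
    using that(2-)
  proof (induction \<gamma> arbitrary: G rule: lead_induct)
    case (less \<gamma>)
    obtain g \<sigma> \<epsilon> b where g: "g \<in> T" "\<epsilon> \<in> exps m" "is_lead lt g \<sigma>" and \<gamma>: "\<gamma> = add_exp \<epsilon> \<sigma>"
      and nz: "poly (g \<sigma>) c \<noteq> 0" "poly b c \<noteq> 0" and b: "(\<lambda>\<alpha>. b * g \<alpha>) \<in> \<aa>"
      using h(2)[OF c less(3,4)] by blast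
    define R where "R = (\<lambda>\<alpha>. g \<sigma> * G \<alpha> + - G \<gamma> * shift \<epsilon> g \<alpha>)"
    have RT: "R \<in> T" unfolding R_def using less g by (intro T_add T_smult T_shift)
    have lower: "lt \<alpha> \<gamma>" if "R \<alpha> \<noteq> 0" for \<alpha>
      using pseudo_reduction[of G \<epsilon> \<sigma> g \<alpha>] less g \<gamma> Tm that by (auto simp: R_def)
    have "\<exists>q. poly q c \<noteq> 0 \<and> (\<lambda>\<alpha>. q * R \<alpha>) \<in> \<aa>"
    proof (cases "R = (\<lambda>_. 0)")
      case False
      then obtain \<gamma>' where \<gamma>': "is_lead lt R \<gamma>'" using ex_lead RT Tm by blast
      then have "R \<gamma>' \<noteq> 0" by (simp add: is_lead_def)
      with RT Tm lower \<gamma>' show ?thesis using less(2)[of \<gamma>' R] mpols_exps by blast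
    qed (use zero RT in blast)
    then obtain q where q: "poly q c \<noteq> 0" "(\<lambda>\<alpha>. q * R \<alpha>) \<in> \<aa>" by blast
    \<comment> \<open>\<open>q\<close> annihilates the remainder and \<open>b\<close> annihilates
      the divisor. Adding back the subtracted multiple of \<open>g\<close> leaves
      \<open>b * q * g \<sigma>\<close> times \<open>G\<close>, and none of these three factors
      vanishes at \<open>c\<close>.\<close>
    have "(\<lambda>\<alpha>. b * (q * R \<alpha>) + (q * G \<gamma>) * shift \<epsilon> (\<lambda>\<alpha>. b * g \<alpha>) \<alpha>) \<in> \<aa>" by (fact | rule submoduleD[OF \<aa>])+
    also have "(\<lambda>\<alpha>. b * (q * R \<alpha>) + (q * G \<gamma>) * shift \<epsilon> (\<lambda>\<alpha>. b * g \<alpha>) \<alpha>)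
        = (\<lambda>\<alpha>. (b * q * g \<sigma>) * G \<alpha>)"
      unfolding shift_smult R_def by (simp add: algebra_simps)
    finally show ?case using q nz by (intro exI[of _ "b * q * g \<sigma>"]) simp
  qed
  show thesis
  proof
    show "h \<noteq> 0" by (rule h(1))
    fix c G assume c: "poly h c \<noteq> 0" and G: "G \<in> mpols m" "(\<lambda>\<alpha>. [:-c, 1:] * G \<alpha>) \<in> \<aa>"
    then have GT: "G \<in> T" unfolding T_def by (auto intro!: exI[of _ "[:-c, 1:]"])
    have "\<exists>q. poly q c \<noteq> 0 \<and> (\<lambda>\<alpha>. q * G \<alpha>) \<in> \<aa>"
    proof (cases "G = (\<lambda>_. 0)")
      case False
      then obtain \<gamma> where \<gamma>: "is_lead lt G \<gamma>" using ex_lead G by blast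
      then have "\<gamma> \<in> exps m" using G(1) mpols_exps by (auto simp: is_lead_def)
      then show ?thesis using kill[OF c _ GT \<gamma>] by blast
    qed (use zero GT in blast)
    then obtain q where q: "poly q c \<noteq> 0" "(\<lambda>\<alpha>. q * G \<alpha>) \<in> \<aa>" by blast
    \<comment> \<open>Bezout for \<open>q\<close> and X_1 - c: since q(c) is a nonzero constant, a
      combination of the two annihilators equals 1.\<close>
    have "[:-c, 1:] dvd q - [:poly q c:]" by (simp add: poly_eq_0_iff_dvd[symmetric])
    then obtain s where s: "q - [:poly q c:] = [:-c, 1:] * s" by (rule dvdE)
    let ?u = "[:inverse (poly q c):]"
    have "x + - y * p = r" if "x - r = p * y" for x y p r :: "'a poly"
      using that by (simp add: algebra_simps)
    then have "?u * (q + - s * [:-c, 1:]) = ?u * [:poly q c:]" using s by metis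
    also have "\<dots> = 1" using q(1) by (simp add: one_pCons)
    finally have u: "?u * (q + - s * [:-c, 1:]) = 1" .
    have "(\<lambda>\<alpha>. ?u * (q * G \<alpha> + - s * ([:-c, 1:] * G \<alpha>))) \<in> \<aa>" by (fact | rule submoduleD[OF \<aa>])+
    also have "(\<lambda>\<alpha>. ?u * (q * G \<alpha> + - s * ([:-c, 1:] * G \<alpha>)))
        = (\<lambda>\<alpha>. (?u * (q + - s * [:-c, 1:])) * G \<alpha>)"
      by (simp only: distrib_right mult.assoc)
    also have "\<dots> = G" unfolding u by simp
    finally show "G \<in> \<aa>" .
  qed
qed

text \<open>Specialization may kill the leading coefficient of \<open>F\<close>. In that case the
  multiple of \<open>g\<close> subtracted by pseudo-division also dies at \<open>c\<close>, so the
  specialization changes only by a nonzero constant while the leading exponent of \<open>F\<close>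
  drops. By well-foundedness it eventually meets the leading exponent of the specialization.\<close>

lemma generic_lead_spec:
  fixes I :: "(nat list \<Rightarrow> 'a::field poly) set"
  assumes I: "submodule m I"
  obtains h :: "'a poly" where "h \<noteq> 0"
    "\<And>c F \<beta>. poly h c \<noteq> 0 \<Longrightarrow> F \<in> I \<Longrightarrow> is_lead lt (spec c F) \<beta> \<Longrightarrow> \<exists>H\<in>I. is_lead lt H \<beta>"
proof -
  have Im: "I \<subseteq> mpols m" using submoduleD(1)[OF I] by blast
  \<comment> \<open>Only leading coefficients matter here, so the witness property is taken to be
    \<open>True\<close>, satisfied by \<open>b = 1\<close>.\<close>
  obtain h where h: "h \<noteq> 0" "\<And>c G \<gamma>. poly h c \<noteq> 0 \<Longrightarrow> G \<in> I \<Longrightarrow> is_lead lt G \<gamma> \<Longrightarrow>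
      \<exists>g\<in>I. \<exists>\<sigma> \<epsilon> b. \<epsilon> \<in> exps m \<and> is_lead lt g \<sigma> \<and> \<gamma> = add_exp \<epsilon> \<sigma> \<and>
        poly (g \<sigma>) c \<noteq> 0 \<and> True \<and> poly b c \<noteq> 0"
    using generic_leading_divisors[OF Im, of "\<lambda>_ _. True"] by (metis zero_neq_one)
  have main: "\<exists>H\<in>I. is_lead lt H \<beta>"
    if c: "poly h c \<noteq> 0" and "\<gamma> \<in> exps m" "F \<in> I" "is_lead lt F \<gamma>" "is_lead lt (spec c F) \<beta>"
    for c F \<gamma> \<beta>
    using that(2-)
  proof (induction \<gamma> arbitrary: F rule: lead_induct)
    case (less \<gamma>)
    show ?case
    proof (cases "\<gamma> = \<beta>")
      case False
      have F\<beta>: "spec c F \<beta> \<noteq> 0" using less(5) by (simp add: is_lead_def)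
      then have "F \<beta> \<noteq> 0" by (auto simp: spec_def)
      then have \<beta>: "\<beta> \<in> exps m" "lt \<beta> \<gamma>"
        using less(3,4) False Im mpols_exps by (auto simp: is_lead_def)
      \<comment> \<open>Otherwise \<gamma> would survive specialization and have to lie below
        \<beta>, against \<open>lt \<beta> \<gamma>\<close>.\<close>
      have spec0: "poly (F \<gamma>) c = 0"
        using less(1,5) \<beta> False irrefl trans[of \<beta> \<gamma> \<beta>] by (auto simp: is_lead_def spec_def)
      obtain g \<sigma> \<epsilon> where g: "g \<in> I" "\<epsilon> \<in> exps m" "is_lead lt g \<sigma>" and \<gamma>: "\<gamma> = add_exp \<epsilon> \<sigma>"
        and nz: "poly (g \<sigma>) c \<noteq> 0"
        using h(2)[OF c less(3,4)] by blast
      define R where "R = (\<lambda>\<alpha>. g \<sigma> * F \<alpha> + - F \<gamma> * shift \<epsilon> g \<alpha>)"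
      have RI: "R \<in> I" unfolding R_def by (fact | rule submoduleD[OF I])+
      have lower: "lt \<alpha> \<gamma>" if "R \<alpha> \<noteq> 0" for \<alpha>
        using pseudo_reduction[of F \<epsilon> \<sigma> g \<alpha>] less g \<gamma> Im that by (auto simp: R_def)
      have specR: "spec c R \<alpha> = poly (g \<sigma>) c * spec c F \<alpha>" for \<alpha>
        by (simp add: R_def spec_def spec0)
      have leadR: "is_lead lt (spec c R) \<beta>"
        using less(5) nz by (simp add: is_lead_def specR)
      have "R \<noteq> (\<lambda>_. 0)" using specR[of \<beta>] nz F\<beta> by (auto simp: spec_def)
      then obtain \<gamma>' where \<gamma>': "is_lead lt R \<gamma>'" using ex_lead RI Im by blast
      then have "R \<gamma>' \<noteq> 0" by (simp add: is_lead_def)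
      with RI Im lower \<gamma>' leadR show ?thesis using less(2)[of \<gamma>' R] mpols_exps by blast
    qed (use less in blast)
  qed
  show thesis
  proof
    show "h \<noteq> 0" by (rule h(1))
    fix c F \<beta> assume c: "poly h c \<noteq> 0" and F: "F \<in> I" "is_lead lt (spec c F) \<beta>"
    then have "F \<noteq> (\<lambda>_. 0)" by (auto simp: is_lead_def spec_def)
    then obtain \<gamma> where \<gamma>: "is_lead lt F \<gamma>" using ex_lead F(1) Im by blast
    then have "\<gamma> \<in> exps m" using F Im mpols_exps by (auto simp: is_lead_def)
    then show "\<exists>H\<in>I. is_lead lt H \<beta>" using main[OF c] F \<gamma> by blast
  qed
qed

end

section \<open>Polynomial functions and retractions onto planes\<close>

definition vanish :: "nat \<Rightarrow> 'a::field list set \<Rightarrow> (nat list \<Rightarrow> 'a poly) set" where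
  "vanish m A = {G \<in> mpols m. \<forall>c a. length a = m \<longrightarrow> c # a \<in> A \<longrightarrow> mp_eval (spec c G) a = 0}"

lemma submodule_vanish: "submodule m (vanish m A)"
  unfolding submodule_def vanish_def
  by (auto simp: exps_def mpols_add mpols_smult shift_mpols
      eval_spec_add[where m = m] eval_spec_smult[where m = m] eval_spec_shift[where m = m])

lemma submodule_sum:
  assumes I: "submodule m I" and L: "submodule m L"
  shows "submodule m {\<lambda>\<alpha>. F \<alpha> + G \<alpha> | F G. F \<in> I \<and> G \<in> L}" (is "submodule m ?K")
proof -
  have K: "(\<lambda>\<alpha>. F \<alpha> + G \<alpha>) \<in> ?K" if "F \<in> I" "G \<in> L" for F G using that by blast
  have "?K \<subseteq> mpols m" using submoduleD(1)[OF I] submoduleD(1)[OF L] by (auto intro: mpols_add)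
  moreover have "(\<lambda>\<alpha>. H \<alpha> + H' \<alpha>) \<in> ?K" if H: "H \<in> ?K" "H' \<in> ?K" for H H'
  proof -
    obtain F G F' G' where *: "F \<in> I" "G \<in> L" "F' \<in> I" "G' \<in> L"
      and eq: "H = (\<lambda>\<alpha>. F \<alpha> + G \<alpha>)" "H' = (\<lambda>\<alpha>. F' \<alpha> + G' \<alpha>)" using H by blast
    have "(\<lambda>\<alpha>. (F \<alpha> + F' \<alpha>) + (G \<alpha> + G' \<alpha>)) \<in> ?K"
      by (rule K) (use submoduleD(2)[OF I] submoduleD(2)[OF L] * in blast)+
    then show ?thesis by (simp add: eq algebra_simps)
  qed
  moreover have "(\<lambda>\<alpha>. q * H \<alpha>) \<in> ?K" if H: "H \<in> ?K" for H q
  proof -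
    obtain F G where *: "F \<in> I" "G \<in> L" and eq: "H = (\<lambda>\<alpha>. F \<alpha> + G \<alpha>)" using H by blast
    have "(\<lambda>\<alpha>. q * F \<alpha> + q * G \<alpha>) \<in> ?K"
      by (rule K) (use submoduleD(3)[OF I] submoduleD(3)[OF L] * in blast)+
    then show ?thesis by (simp add: eq distrib_left)
  qed
  moreover have "shift \<epsilon> H \<in> ?K" if H: "H \<in> ?K" "\<epsilon> \<in> exps m" for H \<epsilon>
  proof -
    obtain F G where *: "F \<in> I" "G \<in> L" and eq: "H = (\<lambda>\<alpha>. F \<alpha> + G \<alpha>)" using H by blast
    have "(\<lambda>\<alpha>. shift \<epsilon> F \<alpha> + shift \<epsilon> G \<alpha>) \<in> ?K"
      by (rule K) (use submoduleD(4)[OF I] submoduleD(4)[OF L] * H in blast)+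
    then show ?thesis by (simp add: eq shift_add)
  qed
  ultimately show ?thesis unfolding submodule_def by blast
qed

text \<open>Substitution into coefficient functions is never constructed; only the existence of a
  polynomial representing the composed function is tracked.\<close>

definition polyfun :: "nat \<Rightarrow> ('a::field \<Rightarrow> 'a list \<Rightarrow> 'a) \<Rightarrow> bool" where
  "polyfun m \<Phi> \<longleftrightarrow> (\<exists>G\<in>mpols m. \<forall>c a. length a = m \<longrightarrow> mp_eval (spec c G) a = \<Phi> c a)"

definition affine_form :: "nat \<Rightarrow> ('a::field \<Rightarrow> 'a list \<Rightarrow> 'a) \<Rightarrow> bool" where
  "affine_form m L \<longleftrightarrow>
     (\<exists>k w. \<forall>c a. length a = m \<longrightarrow> L c a = k + (\<Sum>j<Suc m. w j * (c # a) ! j))"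

lemma polyfun_cong:
  "(\<And>c a. length a = m \<Longrightarrow> \<Phi> c a = \<Psi> c a) \<Longrightarrow> polyfun m \<Phi> \<longleftrightarrow> polyfun m \<Psi>"
  by (simp add: polyfun_def)

lemma polyfun_one: "polyfun m (\<lambda>_ _. 1 :: 'a::field)"
proof -
  let ?G = "\<lambda>\<alpha>. if \<alpha> = replicate m 0 then 1 else 0 :: 'a poly"
  have "?G \<in> mpols m" by (auto simp: mpols_def)
  moreover have "mp_eval (spec c ?G) a = 1" if "length a = m" for c a
    using that by (subst mp_eval_sum[of "{replicate m 0}"]) (auto simp: spec_def mon_def)
  ultimately show ?thesis unfolding polyfun_def by blast
qed

lemma polyfun_add:
  assumes "polyfun m \<Phi>" "polyfun m \<Psi>"
  shows "polyfun m (\<lambda>c a. \<Phi> c a + \<Psi> c a)"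
proof -
  obtain F G where "F \<in> mpols m" "\<And>c a. length a = m \<Longrightarrow> mp_eval (spec c F) a = \<Phi> c a"
    "G \<in> mpols m" "\<And>c a. length a = m \<Longrightarrow> mp_eval (spec c G) a = \<Psi> c a"
    using assms by (auto simp: polyfun_def)
  then show ?thesis unfolding polyfun_def
    by (intro bexI[of _ "\<lambda>\<alpha>. F \<alpha> + G \<alpha>"]) (auto simp: eval_spec_add[where m = m] mpols_add)
qed

lemma polyfun_poly_mult:
  assumes "polyfun m \<Phi>"
  shows "polyfun m (\<lambda>c a. poly q c * \<Phi> c a)"
proof -
  obtain F where "F \<in> mpols m" "\<And>c a. length a = m \<Longrightarrow> mp_eval (spec c F) a = \<Phi> c a"
    using assms by (auto simp: polyfun_def)
  then show ?thesis unfolding polyfun_def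
    by (intro bexI[of _ "\<lambda>\<alpha>. q * F \<alpha>"]) (auto simp: eval_spec_smult[where m = m] mpols_smult)
qed

lemma polyfun_scale: "polyfun m \<Phi> \<Longrightarrow> polyfun m (\<lambda>c a. k * \<Phi> c a)"
  using polyfun_poly_mult[of m \<Phi> "[:k:]"] by simp

lemma polyfun_sum:
  "finite S \<Longrightarrow> (\<And>s. s \<in> S \<Longrightarrow> polyfun m (\<Phi> s)) \<Longrightarrow> polyfun m (\<lambda>c a. \<Sum>s\<in>S. \<Phi> s c a)"
proof (induction rule: finite_induct)
  case empty
  show ?case using polyfun_scale[OF polyfun_one, of m 0] by simp
qed (simp add: polyfun_add)

text \<open>X_1 sits in the coefficient ring, so it acts by the scalar \<open>[:0, 1:]\<close>;
  every other variable acts by a shift.\<close>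

lemma polyfun_coord_mult:
  assumes "polyfun m \<Phi>" "j < Suc m"
  shows "polyfun m (\<lambda>c a. (c # a) ! j * \<Phi> c a)"
proof (cases j)
  case 0
  then show ?thesis using polyfun_poly_mult[OF assms(1), of "[:0, 1:]"] by simp
next
  case (Suc i)
  obtain F where F: "F \<in> mpols m" "\<And>c a. length a = m \<Longrightarrow> mp_eval (spec c F) a = \<Phi> c a"
    using assms(1) by (auto simp: polyfun_def)
  have u: "length (unit_exp m i) = m" by (simp add: unit_exp_def)
  have "mon (unit_exp m i) a = a ! i" if "length a = m" for a :: "'a list"
  proof -
    have "mon (unit_exp m i) a = (\<Prod>l<m. if l = i then a ! l else 1)"
      unfolding mon_def that by (intro prod.cong) (auto simp: unit_exp_def)
    also have "\<dots> = a ! i" using Suc assms(2) by simp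
    finally show ?thesis .
  qed
  then show ?thesis using F u Suc unfolding polyfun_def
    by (intro bexI[of _ "shift (unit_exp m i) F"])
       (auto simp: eval_spec_shift[where m = m] shift_mpols)
qed

lemma polyfun_affine_mult:
  assumes "polyfun m \<Phi>" "affine_form m L"
  shows "polyfun m (\<lambda>c a. L c a * \<Phi> c a)"
proof -
  obtain k w where L: "\<And>c a. length a = m \<Longrightarrow> L c a = k + (\<Sum>j<Suc m. w j * (c # a) ! j)"
    using assms(2) by (auto simp: affine_form_def)
  have "polyfun m (\<lambda>c a. k * \<Phi> c a + (\<Sum>j<Suc m. w j * ((c # a) ! j * \<Phi> c a)))"
    using assms(1) by (intro polyfun_add polyfun_scale polyfun_sum polyfun_coord_mult) auto
  then show ?thesis
    by (subst polyfun_cong[where \<Psi> = "\<lambda>c a. k * \<Phi> c a + (\<Sum>j<Suc m. w j * ((c # a) ! j * \<Phi> c a))"])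
       (simp_all add: L distrib_right sum_distrib_right mult.assoc del: sum.lessThan_Suc)
qed

lemma polyfun_affine_power_mult:
  "polyfun m \<Phi> \<Longrightarrow> affine_form m L \<Longrightarrow> polyfun m (\<lambda>c a. L c a ^ e * \<Phi> c a)"
  by (induction e) (simp_all add: mult.assoc polyfun_affine_mult)

lemma polyfun_affine_monomial:
  "(\<And>i. i < k \<Longrightarrow> affine_form m (L i)) \<Longrightarrow> polyfun m (\<lambda>c a. \<Prod>i<k. L i c a ^ \<alpha> ! i)"
proof (induction k)
  case (Suc k)
  then have "polyfun m (\<lambda>c a. L k c a ^ \<alpha> ! k * (\<Prod>i<k. L i c a ^ \<alpha> ! i))"
    by (intro polyfun_affine_power_mult) auto
  then show ?case by (simp add: mult.commute)
qed (simp add: polyfun_one)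

text \<open>Only X' is substituted and X_1 = c stays fixed, which is the form needed for pulling
  back along a map that preserves the first coordinate.\<close>

lemma polyfun_compose:
  assumes F: "F \<in> mpols m" and L: "\<And>i. i < m \<Longrightarrow> affine_form m (L i)"
  shows "polyfun m (\<lambda>c a. mp_eval (spec c F) (map (\<lambda>i. L i c a) [0..<m]))"
proof -
  let ?S = "{\<alpha>. F \<alpha> \<noteq> 0}"
  have fin: "finite ?S" using F by (simp add: mpols_def)
  have "mp_eval (spec c F) (map (\<lambda>i. L i c a) [0..<m])
      = (\<Sum>\<alpha>\<in>?S. poly (F \<alpha>) c * (\<Prod>i<m. L i c a ^ \<alpha> ! i))" for c a
    using fin by (subst mp_eval_sum[of ?S]) (auto simp: spec_def mon_def)
  then show ?thesis
    using fin L by (simp add: polyfun_sum polyfun_poly_mult polyfun_affine_monomial)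
qed

section \<open>Affine planes and their retractions\<close>

lemma affine_plane_length:
  assumes "affine_plane n d P" "x \<in> P"
  shows "length x = n"
  using assms by (auto simp: affine_plane_def lincomb_def)

text \<open>The parameters of the new point are the same affine combination of the three parameter
  lists. This closure allows points of the plane to be built up one direction at a time.\<close>

lemma affine_plane_closed:
  assumes P: "affine_plane n d P" and pqr: "p \<in> P" "q \<in> P" "r \<in> P"
  shows "map (\<lambda>i. p ! i + t * (q ! i - r ! i)) [0..<n] \<in> P"
proof -
  obtain a0 vs where a0: "length a0 = n" "length vs = d"
    and P_eq: "P = {map2 (+) a0 (lincomb n ts vs) | ts. length ts = d}"
    using P by (auto simp: affine_plane_def)
  obtain ps qs rs where len: "length ps = d" "length qs = d" "length rs = d"
    and eq: "p = map2 (+) a0 (lincomb n ps vs)" "q = map2 (+) a0 (lincomb n qs vs)"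
      "r = map2 (+) a0 (lincomb n rs vs)"
    using pqr unfolding P_eq by blast
  define ts where "ts = map (\<lambda>j. ps ! j + t * (qs ! j - rs ! j)) [0..<d]"
  have nth: "map2 (+) a0 (lincomb n us vs) ! i = a0 ! i + (\<Sum>j<d. us ! j * vs ! j ! i)"
    if "i < n" for us i
    using that a0 by (simp add: lincomb_def)
  have "map (\<lambda>i. p ! i + t * (q ! i - r ! i)) [0..<n] = map2 (+) a0 (lincomb n ts vs)"
  proof (rule nth_equalityI)
    fix i assume "i < length (map (\<lambda>i. p ! i + t * (q ! i - r ! i)) [0..<n])"
    then have i: "i < n" by simp
    have "(\<Sum>j<d. ts ! j * vs ! j ! i) = (\<Sum>j<d. ps ! j * vs ! j ! i
        + t * (qs ! j * vs ! j ! i - rs ! j * vs ! j ! i))"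
      by (intro sum.cong) (auto simp: ts_def algebra_simps)
    also have "\<dots> = (\<Sum>j<d. ps ! j * vs ! j ! i)
        + t * ((\<Sum>j<d. qs ! j * vs ! j ! i) - (\<Sum>j<d. rs ! j * vs ! j ! i))"
      by (simp add: sum.distrib sum_subtractf flip: sum_distrib_left)
    finally show "map (\<lambda>i. p ! i + t * (q ! i - r ! i)) [0..<n] ! i
        = map2 (+) a0 (lincomb n ts vs) ! i"
      using i by (simp add: eq nth[OF i] del: nth_map) (simp add: nth[OF i])
  qed (simp add: a0 lincomb_def)
  moreover have "length ts = d" by (simp add: ts_def)
  ultimately show ?thesis unfolding P_eq by blast
qed

text \<open>The retraction sends a point to the point of the plane with the same free coordinates; it
  preserves the first coordinate because that coordinate is free.\<close>

lemma affine_retraction: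
  fixes P :: "'a::field list set"
  assumes P: "affine_plane (Suc m) d P" and J: "free_vars (Suc m) d P J" "0 \<in> J"
  obtains L where "\<And>i. i < m \<Longrightarrow> affine_form m (L i)"
    "\<And>c a. length a = m \<Longrightarrow> c # map (\<lambda>i. L i c a) [0..<m] \<in> P"
    "\<And>c a. c # a \<in> P \<Longrightarrow> map (\<lambda>i. L i c a) [0..<m] = a"
proof -
  have Jsub: "J \<subseteq> {..<Suc m}" and ex1: "\<And>y :: nat \<Rightarrow> 'a. \<exists>!x. x \<in> P \<and> (\<forall>j\<in>J. x ! j = y j)"
    using J(1) by (auto simp: free_vars_def)
  have finJ: "finite J" using Jsub by (rule finite_subset) simp
  \<comment> \<open>\<open>p0\<close> has all free coordinates 0 and \<open>e l\<close> has those of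
    the l-th unit vector. Adding the directions \<open>e l - p0\<close> with weights
    \<open>y l\<close> therefore reaches the point with free coordinates \<open>y\<close>.\<close>
  obtain p0 where p0: "p0 \<in> P" "\<And>j. j \<in> J \<Longrightarrow> p0 ! j = 0" using ex1[of "\<lambda>_. 0"] by auto
  have "\<exists>x. x \<in> P \<and> (\<forall>j\<in>J. x ! j = (if j = l then 1 else 0))" for l
    using ex1[of "\<lambda>j. if j = l then 1 else 0"] by blast
  then obtain e where e: "\<And>l. e l \<in> P" "\<And>l j. j \<in> J \<Longrightarrow> e l ! j = (if j = l then 1 else 0)"
    by metis
  define z where "z K y = map (\<lambda>i. p0 ! i + (\<Sum>j\<in>K. y j * (e j ! i - p0 ! i))) [0..<Suc m]"
    for K and y :: "nat \<Rightarrow> 'a"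
  have zP: "z K y \<in> P" if "finite K" for K y
    using that
  proof (induction K rule: finite_induct)
    case empty
    have "z {} y = p0"
      using affine_plane_length[OF P p0(1)] unfolding z_def by (intro nth_equalityI) (auto simp del: upt_Suc)
    then show ?case using p0 by simp
  next
    case (insert l K)
    have "map (\<lambda>i. z K y ! i + y l * (e l ! i - p0 ! i)) [0..<Suc m] \<in> P"
      using insert e p0 by (intro affine_plane_closed[OF P])
    also have "map (\<lambda>i. z K y ! i + y l * (e l ! i - p0 ! i)) [0..<Suc m] = z (insert l K) y"
      using insert by (intro nth_equalityI) (auto simp: z_def simp del: upt_Suc)
    finally show ?case .
  qed
  have znth: "z J y ! j = y j" if j: "j \<in> J" for j y
  proof -
    have "z J y ! j = p0 ! j + (\<Sum>l\<in>J. y l * (e l ! j - p0 ! j))"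
      using j Jsub by (auto simp: z_def simp del: upt_Suc)
    also have "\<dots> = (\<Sum>l\<in>J. if j = l then y l else 0)"
    proof -
      have "y l * (e l ! j - 0) = (if j = l then y l else 0)" for l by (simp add: e(2)[OF j])
      then show ?thesis by (simp only: p0(2)[OF j] add_0_left)
    qed
    also have "\<dots> = y j" using finJ j by simp
    finally show ?thesis .
  qed
  \<comment> \<open>Both points lie in \<open>P\<close> and share their free coordinates, so
    uniqueness identifies them.\<close>
  have zfix: "z J (\<lambda>j. x ! j) = x" if "x \<in> P" for x
    using ex1[of "\<lambda>j. x ! j"] that zP[OF finJ] znth by blast
  \<comment> \<open>The offset \<open>Suc i\<close> skips coordinate 0, which the retraction leaves
    unchanged.\<close>
  define L where "L i c a = z J (\<lambda>j. (c # a) ! j) ! Suc i" for i c a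
  have zL: "z J (\<lambda>j. (c # a) ! j) = c # map (\<lambda>i. L i c a) [0..<m]" for c a
  proof (rule nth_equalityI)
    fix i assume "i < length (z J (\<lambda>j. (c # a) ! j))"
    then have "i < Suc m" by (simp add: z_def)
    then show "z J (\<lambda>j. (c # a) ! j) ! i = (c # map (\<lambda>i. L i c a) [0..<m]) ! i"
      using znth[OF J(2)] by (cases i) (auto simp: L_def)
  qed (simp add: z_def)
  show thesis
  proof
    fix i assume i: "i < m"
    define w where "w j = (if j \<in> J then e j ! Suc i - p0 ! Suc i else 0)" for j
    have "L i c a = p0 ! Suc i + (\<Sum>j<Suc m. w j * (c # a) ! j)" for c a
    proof -
      have "L i c a = p0 ! Suc i + (\<Sum>j\<in>J. w j * (c # a) ! j)"
        using i by (simp add: L_def z_def w_def mult.commute del: upt_Suc)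
      also have "(\<Sum>j\<in>J. w j * (c # a) ! j) = (\<Sum>j<Suc m. w j * (c # a) ! j)"
        using Jsub by (intro sum.mono_neutral_left) (auto simp: w_def)
      finally show ?thesis .
    qed
    then show "affine_form m (L i)" unfolding affine_form_def by blast
  next
    fix c :: 'a and a
    show "c # map (\<lambda>i. L i c a) [0..<m] \<in> P" using zP[OF finJ] zL by metis
    show "map (\<lambda>i. L i c a) [0..<m] = a" if "c # a \<in> P"
      using zfix[OF that] zL[of c a] by simp
  qed
qed

section \<open>Lifting the ideal of a generic fiber\<close>

context monomial_order
begin

text \<open>The polynomial \<open>h\<close> must not depend on \<open>F\<close>. Each new plane
  multiplies it by the torsion polynomial of the corresponding sum of ideals, which depends on the
  planes alone.\<close>

lemma generic_lift:
  fixes Planes :: "'a::field list set set"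
  assumes inf: "infinite (UNIV :: 'a set)"
    and "finite Planes"
    and "\<And>P. P \<in> Planes \<Longrightarrow> affine_plane (Suc m) d P \<and> (\<exists>J. free_vars (Suc m) d P J \<and> 0 \<in> J)"
  shows "\<exists>h :: 'a poly. h \<noteq> 0 \<and> (\<forall>c F. poly h c \<noteq> 0 \<longrightarrow> F \<in> mpols m \<longrightarrow>
    (\<forall>a. length a = m \<longrightarrow> c # a \<in> \<Union> Planes \<longrightarrow> mp_eval (spec c F) a = 0) \<longrightarrow>
    (\<exists>G\<in>vanish m (\<Union> Planes). spec c G = spec c F))"
  using assms(2,3)
proof (induction Planes rule: finite_induct)
  case empty
  show ?case by (intro exI[of _ 1]) (auto simp: vanish_def)
next
  case (insert P Planes)
  let ?A = "\<Union> Planes" and ?B = "\<Union> (insert P Planes)"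
  have P: "affine_plane (Suc m) d P" using insert.prems by blast
  obtain J where J: "free_vars (Suc m) d P J" "0 \<in> J" using insert.prems by blast
  obtain h1 :: "'a poly" where h1: "h1 \<noteq> 0" "\<And>c F. poly h1 c \<noteq> 0 \<Longrightarrow> F \<in> mpols m \<Longrightarrow>
      (\<forall>a. length a = m \<longrightarrow> c # a \<in> ?A \<longrightarrow> mp_eval (spec c F) a = 0) \<Longrightarrow>
      \<exists>G\<in>vanish m ?A. spec c G = spec c F"
    using insert.IH insert.prems by (metis insertCI)
  obtain L where L: "\<And>i. i < m \<Longrightarrow> affine_form m (L i)"
    "\<And>c a. length a = m \<Longrightarrow> c # map (\<lambda>i. L i c a) [0..<m] \<in> P"
    "\<And>c a. c # a \<in> P \<Longrightarrow> map (\<lambda>i. L i c a) [0..<m] = a"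
    using affine_retraction[OF P J] by blast
  let ?\<aa> = "{\<lambda>\<alpha>. F \<alpha> + G \<alpha> | F G. F \<in> vanish m ?A \<and> G \<in> vanish m P}"
  have sub: "submodule m ?\<aa>" by (intro submodule_sum submodule_vanish)
  obtain h2 :: "'a poly" where h2: "h2 \<noteq> 0" "\<And>c G. poly h2 c \<noteq> 0 \<Longrightarrow> G \<in> mpols m \<Longrightarrow>
      (\<lambda>\<alpha>. [:-c, 1:] * G \<alpha>) \<in> ?\<aa> \<Longrightarrow> G \<in> ?\<aa>"
    using generic_torsion_free[OF sub] by blast
  have "\<exists>G\<in>vanish m ?B. spec c G = spec c F"
    if c: "poly (h1 * h2) c \<noteq> 0" and F: "F \<in> mpols m"
      and F0: "\<forall>a. length a = m \<longrightarrow> c # a \<in> ?B \<longrightarrow> mp_eval (spec c F) a = 0" for c F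
  proof -
    have "poly h1 c \<noteq> 0" "poly h2 c \<noteq> 0" using c by auto
    obtain F1 where F1: "F1 \<in> vanish m ?A" "spec c F1 = spec c F"
      using h1(2)[OF \<open>poly h1 c \<noteq> 0\<close> F] F0 by auto
    have F1m: "F1 \<in> mpols m" using F1 by (simp add: vanish_def)
    \<comment> \<open>\<Phi> is the restriction of \<open>F1\<close> to \<open>P\<close>, extended
      to the whole space through the retraction.\<close>
    obtain \<Phi> where \<Phi>: "\<Phi> \<in> mpols m" "\<And>c a. length a = m \<Longrightarrow>
        mp_eval (spec c \<Phi>) a = mp_eval (spec c F1) (map (\<lambda>i. L i c a) [0..<m])"
      using polyfun_compose[of F1 m L, OF F1m L(1)] unfolding polyfun_def by blast
    have "mp_eval (spec c \<Phi>) a = 0" if "length a = m" for a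
      using \<Phi>(2)[OF that] F1(2) F0 L(2)[OF that] by simp
    \<comment> \<open>Over \<open>c\<close> the retraction lands in the fiber of \<open>P\<close>,
      where \<open>F\<close> vanishes. As the field is infinite, a function that is zero everywhere
      has zero coefficients, so X_1 - c divides every coefficient of \<Phi>.\<close>
    then have "spec c \<Phi> = (\<lambda>_. 0)" using mp_eval_eq_0_imp[OF inf spec_mpols[OF \<Phi>(1)]] by blast
    then have "[:-c, 1:] dvd \<Phi> \<alpha>" for \<alpha>
      by (metis poly_eq_0_iff_dvd spec_def)
    then obtain G where G: "\<And>\<alpha>. \<Phi> \<alpha> = [:-c, 1:] * G \<alpha>" unfolding dvd_def by metis
    have Gm: "G \<in> mpols m"
      by (rule mpols_subsupport[OF \<Phi>(1)]) (metis G mult_eq_0_iff pCons_eq_0_iff one_neq_zero)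
    define D where "D = (\<lambda>\<alpha>. F1 \<alpha> + (-1) * \<Phi> \<alpha>)"
    have DP: "D \<in> vanish m P"
    proof -
      have "mp_eval (spec c' D) a = 0" if "length a = m" "c' # a \<in> P" for c' a
        unfolding D_def
        using F1m \<Phi> L(3)[OF that(2)] that(1)
        by (simp only: eval_spec_add[where m = m] eval_spec_smult[where m = m] mpols_smult) simp
      moreover have "D \<in> mpols m" unfolding D_def using F1m \<Phi>(1) by (intro mpols_add mpols_smult)
      ultimately show ?thesis by (simp add: vanish_def)
    qed
    have "(\<lambda>\<alpha>. F1 \<alpha> + (-1) * D \<alpha>) \<in> ?\<aa>"
      using F1(1) submoduleD(3)[OF submodule_vanish DP, of "-1"]
      by (intro CollectI exI[of _ F1] exI[of _ "\<lambda>\<alpha>. - 1 * D \<alpha>"]) simp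
    also have "(\<lambda>\<alpha>. F1 \<alpha> + (-1) * D \<alpha>) = (\<lambda>\<alpha>. [:-c, 1:] * G \<alpha>)"
      unfolding D_def G[symmetric] by simp
    finally have "(\<lambda>\<alpha>. [:-c, 1:] * G \<alpha>) \<in> ?\<aa>" .
    then have "G \<in> ?\<aa>" by (rule h2(2)[OF \<open>poly h2 c \<noteq> 0\<close> Gm])
    then obtain a b where a: "a \<in> vanish m ?A" and b: "b \<in> vanish m P"
      and Gab: "G = (\<lambda>\<alpha>. a \<alpha> + b \<alpha>)" by blast
    \<comment> \<open>Since F1 = D + (X_1 - c)(a + b), removing (X_1 - c) a keeps \<open>F1\<close>
      in the ideal of the old planes and leaves D + (X_1 - c) b, which vanishes on \<open>P\<close>.
      At X_1 = c nothing changes.\<close>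
    define F' where "F' = (\<lambda>\<alpha>. F1 \<alpha> + (- [:-c, 1:]) * a \<alpha>)"
    have "F' \<in> vanish m ?A" unfolding F'_def
      by (fact | rule submoduleD[OF submodule_vanish])+
    moreover have "F' \<in> vanish m P"
    proof -
      have "(\<lambda>\<alpha>. D \<alpha> + [:-c, 1:] * b \<alpha>) \<in> vanish m P"
        by (fact | rule submoduleD[OF submodule_vanish])+
      also have "(\<lambda>\<alpha>. D \<alpha> + [:-c, 1:] * b \<alpha>) = F'"
      proof -
        have "x + (-1) * (p * (y + z)) + p * z = x + (- p) * y" for x y z p :: "'a poly"
          by (simp add: algebra_simps)
        then show ?thesis unfolding D_def F'_def G Gab by (simp only:)
      qed
      finally show ?thesis .
    qed
    ultimately have "F' \<in> vanish m ?B" by (auto simp: vanish_def)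
    moreover have "spec c F' = spec c F" unfolding F1(2)[symmetric] by (simp add: F'_def spec_def)
    ultimately show ?thesis by blast
  qed
  then show ?case using h1(1) h2(1) by (intro exI[of _ "h1 * h2"]) auto
qed

lemma Cset_eq: "Cset m lt B = {\<alpha>. \<exists>f\<in>vanishing_ideal m B. is_lead lt f \<alpha>}"
proof -
  have "f \<in> mpols m" if "f \<in> vanishing_ideal m B" for f
    using that by (simp add: vanishing_ideal_def mpolys_eq_mpols)
  moreover have "f \<noteq> (\<lambda>_. 0)" if "is_lead lt f \<alpha>" for f :: "nat list \<Rightarrow> 'a::field" and \<alpha>
    using that by (auto simp: is_lead_def)
  ultimately show ?thesis unfolding Cset_def using lead_exp_eq ex_lead by blast
qed

end

section \<open>Product orders\<close>

lemma add_exp_commute: "add_exp \<alpha> \<beta> = add_exp \<beta> \<alpha>"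
  by (intro nth_equalityI) (auto simp: nth_add_exp add.commute)

lemma monomial_order_if_term_order:
  assumes "term_order n ord"
  shows "monomial_order n ord"
proof
  have add: "\<forall>\<alpha>\<in>exps n. \<forall>\<beta>\<in>exps n. \<forall>\<epsilon>\<in>exps n.
      ord \<alpha> \<beta> \<longrightarrow> ord (add_exp \<alpha> \<epsilon>) (add_exp \<beta> \<epsilon>)"
    using assms unfolding term_order_def by (elim conjE)
  fix \<alpha> \<beta> \<epsilon> assume "\<alpha> \<in> exps n" "\<beta> \<in> exps n" "\<epsilon> \<in> exps n" "ord \<alpha> \<beta>"
  then have "ord (add_exp \<alpha> \<epsilon>) (add_exp \<beta> \<epsilon>)" using add by blast
  then show "ord (add_exp \<epsilon> \<alpha>) (add_exp \<epsilon> \<beta>)" by (simp only: add_exp_commute[of \<epsilon>])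
qed (use assms in \<open>unfold term_order_def, elim conjE, (assumption | blast)+\<close>)

lemma monomial_order_restrict:
  assumes "monomial_order (Suc m) ord"
  shows "monomial_order m (restrict_order ord)"
proof -
  interpret monomial_order "Suc m" ord by (rule assms)
  have e: "0 # \<alpha> \<in> exps (Suc m) \<longleftrightarrow> \<alpha> \<in> exps m" for \<alpha> by (simp add: exps_def)
  show ?thesis
  proof
    have "wf (inv_image {(\<alpha>, \<beta>). \<alpha> \<in> exps (Suc m) \<and> \<beta> \<in> exps (Suc m) \<and> ord \<alpha> \<beta>} ((#) 0))"
      by (rule wf_inv_image[OF wf])
    then show "wf {(\<alpha>, \<beta>). \<alpha> \<in> exps m \<and> \<beta> \<in> exps m \<and> restrict_order ord \<alpha> \<beta>}"
      by (rule wf_subset) (auto simp: inv_image_def e restrict_order_def)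
  next
    fix \<alpha> \<beta> \<epsilon> assume *: "\<alpha> \<in> exps m" "\<beta> \<in> exps m" "\<epsilon> \<in> exps m" "restrict_order ord \<alpha> \<beta>"
    then have "ord (add_exp (0 # \<epsilon>) (0 # \<alpha>)) (add_exp (0 # \<epsilon>) (0 # \<beta>))"
      by (intro add_mono) (auto simp: e restrict_order_def)
    then show "restrict_order ord (add_exp \<epsilon> \<alpha>) (add_exp \<epsilon> \<beta>)"
      by (simp add: add_exp_Cons restrict_order_def)
  next
    fix \<alpha> \<beta> \<gamma> assume "\<alpha> \<in> exps m" "\<beta> \<in> exps m" "\<gamma> \<in> exps m"
      "restrict_order ord \<alpha> \<beta>" "restrict_order ord \<beta> \<gamma>"
    then show "restrict_order ord \<alpha> \<gamma>"
      using trans[of "0 # \<alpha>" "0 # \<beta>" "0 # \<gamma>"] by (simp add: e restrict_order_def)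
  next
    fix \<alpha> \<beta> assume "\<alpha> \<in> exps m" "\<beta> \<in> exps m" "\<alpha> \<noteq> \<beta>"
    then show "restrict_order ord \<alpha> \<beta> \<or> restrict_order ord \<beta> \<alpha>"
      using total[of "0 # \<alpha>" "0 # \<beta>"] by (simp add: e restrict_order_def)
  next
    fix \<alpha> assume "\<alpha> \<in> exps m"
    then show "\<not> restrict_order ord \<alpha> \<alpha>" using irrefl[of "0 # \<alpha>"] by (simp add: e restrict_order_def)
  qed
qed

lemma product_order_Cons:
  assumes "product_order (Suc m) ord" "\<alpha> \<in> exps m" "\<beta> \<in> exps m"
  shows "ord (s # \<alpha>) (t # \<beta>) \<longleftrightarrow> restrict_order ord \<alpha> \<beta> \<or> \<alpha> = \<beta> \<and> s < t"
  using assms by (auto simp: product_order_def exps_def)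

text \<open>The order compares X'-exponents first, and for equal ones the X_1-degree decides. One
  direction reads an element of I(A) over k[X_1], the other returns a constructed element to n
  variables.\<close>

lemma is_lead_product_order:
  fixes f :: "nat list \<Rightarrow> 'a::field"
  assumes po: "product_order (Suc m) ord" and f: "f \<in> mpols (Suc m)"
    and G: "\<And>\<gamma> t. coeff (G \<gamma>) t = f (t # \<gamma>)"
  shows "is_lead (restrict_order ord) G \<beta> \<Longrightarrow> is_lead ord f (degree (G \<beta>) # \<beta>)"
    and "is_lead ord f (t # \<beta>) \<Longrightarrow> is_lead (restrict_order ord) G \<beta>"
proof -
  have Gm: "G \<in> mpols m" by (rule mp_eval_Cons(2)[OF f G])
  have ex: "\<gamma> \<in> exps m" if "G \<gamma> \<noteq> 0" for \<gamma> using Gm that by (simp add: mpols_def exps_def)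
  have nz: "G \<gamma> \<noteq> 0" if "f (s # \<gamma>) \<noteq> 0" for s \<gamma> using that by (metis G coeff_0)
  have nil: "f [] = 0" using f by (auto simp: mpols_def)
  {
    assume lead: "is_lead (restrict_order ord) G \<beta>"
    then have G\<beta>: "G \<beta> \<noteq> 0" by (simp add: is_lead_def)
    have "ord \<alpha> (degree (G \<beta>) # \<beta>)" if \<alpha>: "f \<alpha> \<noteq> 0" "\<alpha> \<noteq> degree (G \<beta>) # \<beta>" for \<alpha>
    proof -
      obtain s \<gamma> where s: "\<alpha> = s # \<gamma>" using \<alpha> nil by (cases \<alpha>) auto
      then have G\<gamma>: "G \<gamma> \<noteq> 0" and "s \<le> degree (G \<gamma>)" using \<alpha> nz G by (auto intro: le_degree)
      then show ?thesis
        using s \<alpha>(2) lead product_order_Cons[OF po ex[OF G\<gamma>] ex[OF G\<beta>]]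
        by (cases "\<gamma> = \<beta>") (auto simp: is_lead_def)
    qed
    moreover have "f (degree (G \<beta>) # \<beta>) \<noteq> 0" using G\<beta> by (simp flip: G)
    ultimately show "is_lead ord f (degree (G \<beta>) # \<beta>)" by (simp add: is_lead_def)
  }
  {
    assume lead: "is_lead ord f (t # \<beta>)"
    then have G\<beta>: "G \<beta> \<noteq> 0" using nz by (auto simp: is_lead_def)
    have "restrict_order ord \<gamma> \<beta>" if \<gamma>: "G \<gamma> \<noteq> 0" "\<gamma> \<noteq> \<beta>" for \<gamma>
    proof -
      have "f (degree (G \<gamma>) # \<gamma>) \<noteq> 0" using \<gamma> by (simp flip: G)
      then have "ord (degree (G \<gamma>) # \<gamma>) (t # \<beta>)" using lead \<gamma> by (auto simp: is_lead_def)
      with product_order_Cons[OF po ex[OF \<gamma>(1)] ex[OF G\<beta>]] \<gamma>(2) show ?thesis by blast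
    qed
    with G\<beta> show "is_lead (restrict_order ord) G \<beta>" by (simp add: is_lead_def)
  }
qed

section \<open>Generic parameters and the final comparison\<close>

lemma zariski_open_line_cofinite:
  assumes "zariski_open_line U" "U \<noteq> {}"
  obtains u :: "'a::field poly" where "u \<noteq> 0" "\<And>c. poly u c \<noteq> 0 \<Longrightarrow> c \<in> U"
proof -
  obtain S where S: "U = - {x. \<forall>p\<in>S. poly p x = 0}" using assms by (auto simp: zariski_open_line_def)
  with assms(2) obtain x u where "u \<in> S" "poly u x \<noteq> 0" by blast
  with S show thesis by (intro that[of u]) auto
qed

lemma ex_nonroot:
  assumes "infinite (UNIV :: 'a::field set)" "(p :: 'a poly) \<noteq> 0"
  shows "\<exists>c. poly p c \<noteq> 0"
  using poly_roots_finite[OF assms(2)] assms(1) by (metis (mono_tags) UNIV_I finite_subset mem_Collect_eq subsetI)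

theorem mainTheorem9:
  fixes n d :: nat and ord :: "nat list \<Rightarrow> nat list \<Rightarrow> bool"
    and Planes :: "'a::field list set set" and A :: "'a list set" and \<delta> :: "nat list set"
  assumes inf: "infinite (UNIV :: 'a set)"
    and n2: "n \<ge> 2"
    and to: "term_order n ord"
    and po: "product_order n ord"
    and vars: "\<forall>i j. i < j \<longrightarrow> j < n \<longrightarrow> ord (unit_exp n i) (unit_exp n j)"
    and finP: "finite Planes"
    and planes: "\<forall>P\<in>Planes. affine_plane n d P"
    and A_def: "A = \<Union> Planes"
    and minfree: "\<forall>P\<in>Planes. \<exists>J. minimal_free_vars n d P J \<and> 0 \<in> J"
    and generic: "\<exists>U. zariski_open_line U \<and> U \<noteq> {} \<and>
                    (\<forall>c\<in>U. Dset (n - 1) (restrict_order ord) (fiber A c) = \<delta>)"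
  shows "{\<alpha> \<in> exps n. tl \<alpha> \<in> \<delta>} \<subseteq> Dset n ord A \<and>
         (\<forall>\<beta>\<in>exps (n - 1). {t # \<beta> | t. True} \<subseteq> Dset n ord A \<longleftrightarrow> \<beta> \<in> \<delta>)"
proof -
  define m where "m = n - 1"
  have n: "n = Suc m" using n2 by (simp add: m_def)
  let ?r = "restrict_order ord"
  interpret N: monomial_order "Suc m" ord
    using monomial_order_if_term_order[OF to] by (simp only: n)
  interpret M: monomial_order m ?r
    by (rule monomial_order_restrict) (rule N.monomial_order_axioms)
  have po': "product_order (Suc m) ord" using po by (simp only: n)
  have lenA: "length x = Suc m" if "x \<in> A" for x
    using that planes affine_plane_length unfolding A_def n by blast
  obtain U where U: "zariski_open_line U" "U \<noteq> {}"
    and \<delta>: "\<And>c. c \<in> U \<Longrightarrow> Dset m ?r (fiber A c) = \<delta>"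
    using generic by (auto simp: m_def)
  obtain u where u: "u \<noteq> 0" "\<And>c. poly u c \<noteq> 0 \<Longrightarrow> c \<in> U"
    using zariski_open_line_cofinite[OF U] by blast
  have below: "\<alpha> \<in> Dset (Suc m) ord A" if \<alpha>: "\<alpha> \<in> exps (Suc m)" "tl \<alpha> \<in> \<delta>" for \<alpha>
  proof (rule ccontr)
    assume "\<alpha> \<notin> Dset (Suc m) ord A"
    then obtain f where f: "f \<in> vanishing_ideal (Suc m) A" "is_lead ord f \<alpha>"
      using \<alpha>(1) by (auto simp: Dset_def N.Cset_eq)
    then have fm: "f \<in> mpols (Suc m)" by (simp add: vanishing_ideal_def mpolys_eq_mpols)
    obtain t \<beta> where t: "\<alpha> = t # \<beta>" using \<alpha>(1) by (cases \<alpha>) (auto simp: exps_def)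
    obtain G where G: "\<And>\<gamma> t. coeff (G \<gamma>) t = f (t # \<gamma>)"
      using separate_first_variable[OF fm] by metis
    have Gm: "G \<in> mpols m" by (rule mp_eval_Cons(2)[OF fm G])
    have lead: "is_lead ?r G \<beta>" using is_lead_product_order(2)[OF po' fm G] f(2) t by blast
    \<comment> \<open>A nonroot of this product is a parameter in \<open>U\<close> at which the
      leading coefficient in k[X_1] survives.\<close>
    then have "u * G \<beta> \<noteq> 0" using u by (simp add: is_lead_def)
    then obtain c where c: "poly (u * G \<beta>) c \<noteq> 0" using ex_nonroot[OF inf] by blast
    then have "c \<in> U" and G\<beta>: "poly (G \<beta>) c \<noteq> 0" using u by auto
    have "is_lead ?r (spec c G) \<beta>"
      using lead G\<beta> unfolding is_lead_def spec_def by (metis poly_0)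
    moreover have "mp_eval (spec c G) a = 0" if "a \<in> fiber A c" for a
    proof -
      have "c # a \<in> A" using that by (simp add: fiber_def)
      then show ?thesis
        using f(1) mp_eval_Cons(1)[OF fm G, of c a] by (simp add: vanishing_ideal_def)
    qed
    ultimately have "\<beta> \<in> Cset m ?r (fiber A c)"
      using spec_mpols[OF Gm] by (auto simp: M.Cset_eq vanishing_ideal_def mpolys_eq_mpols)
    then show False using \<delta>[OF \<open>c \<in> U\<close>] \<alpha>(2) t by (auto simp: Dset_def)
  qed
  have above: "\<exists>t. t # \<beta> \<notin> Dset (Suc m) ord A" if \<beta>: "\<beta> \<in> exps m" "\<beta> \<notin> \<delta>" for \<beta>
  proof -
    have planes': "affine_plane (Suc m) d P \<and> (\<exists>J. free_vars (Suc m) d P J \<and> 0 \<in> J)"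
      if "P \<in> Planes" for P
      using that planes minfree n by (auto simp: minimal_free_vars_def)
    obtain h1 :: "'a poly" where h1: "h1 \<noteq> 0" "\<And>c F. poly h1 c \<noteq> 0 \<Longrightarrow> F \<in> mpols m \<Longrightarrow>
        \<forall>a. length a = m \<longrightarrow> c # a \<in> A \<longrightarrow> mp_eval (spec c F) a = 0 \<Longrightarrow>
        \<exists>G\<in>vanish m A. spec c G = spec c F"
      using M.generic_lift[OF inf finP planes'] unfolding A_def by blast
    obtain h2 :: "'a poly" where h2: "h2 \<noteq> 0" "\<And>c F \<beta>. poly h2 c \<noteq> 0 \<Longrightarrow> F \<in> vanish m A \<Longrightarrow>
        is_lead ?r (spec c F) \<beta> \<Longrightarrow> \<exists>H\<in>vanish m A. is_lead ?r H \<beta>"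
      using M.generic_lead_spec[OF submodule_vanish[of m A]] by blast
    \<comment> \<open>One parameter must at once give the generic standard set, allow lifting, and
      allow recovery of the leading exponent.\<close>
    have "u * h1 * h2 \<noteq> 0" using u h1 h2 by simp
    then obtain c where "poly (u * h1 * h2) c \<noteq> 0" using ex_nonroot[OF inf] by blast
    then have "c \<in> U" and c: "poly h1 c \<noteq> 0" "poly h2 c \<noteq> 0" using u by auto
    then have "\<beta> \<in> Cset m ?r (fiber A c)" using \<delta> \<beta> by (auto simp: Dset_def)
    then obtain f where f: "f \<in> vanishing_ideal m (fiber A c)" "is_lead ?r f \<beta>"
      by (auto simp: M.Cset_eq)
    \<comment> \<open>The constant extension of \<open>f\<close> in X_1 specializes to
      \<open>f\<close> but need not vanish on \<open>A\<close>; the lifting lemma replaces it by an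
      element of the ideal with the same specialization at \<open>c\<close>.\<close>
    define F where "F = (\<lambda>\<alpha>. [:f \<alpha>:])"
    have specF: "spec c F = f" by (simp add: F_def spec_def)
    have Fm: "F \<in> mpols m"
      by (rule mpols_subsupport[of f]) (use f in \<open>auto simp: F_def vanishing_ideal_def mpolys_eq_mpols\<close>)
    have "\<exists>G\<in>vanish m A. spec c G = spec c F"
      using f(1) by (intro h1(2)[OF c(1) Fm]) (auto simp: specF vanishing_ideal_def fiber_def)
    then obtain H where H: "H \<in> vanish m A" "is_lead ?r H \<beta>"
      using h2(2)[OF c(2)] f(2) specF by metis
    then have "H \<in> mpols m" by (simp add: vanish_def)
    then obtain g where g: "g \<in> mpols (Suc m)" "\<And>\<gamma> t. coeff (H \<gamma>) t = g (t # \<gamma>)"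
      using combine_first_variable by metis
    have "mp_eval g x = 0" if x: "x \<in> A" for x
    proof -
      obtain b a where "x = b # a" "length a = m" using lenA[OF x] by (cases x) auto
      then show ?thesis using H(1) x mp_eval_Cons(1)[OF g, of b a] by (simp add: vanish_def)
    qed
    then have "g \<in> vanishing_ideal (Suc m) A" using g by (simp add: vanishing_ideal_def mpolys_eq_mpols)
    then have "degree (H \<beta>) # \<beta> \<in> Cset (Suc m) ord A"
      using is_lead_product_order(1)[OF po' g H(2)] by (auto simp: N.Cset_eq)
    then show ?thesis by (auto simp: Dset_def)
  qed
  have "t # \<beta> \<in> Dset (Suc m) ord A" if "\<beta> \<in> exps m" "\<beta> \<in> \<delta>" for t \<beta>
    using that by (intro below) (auto simp: exps_def)
  then show ?thesis
    unfolding n diff_Suc_1 using below above by blast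
qed

end
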